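(* The compact manifold $M^6=S_{1,\frac{\pi}{2}}/\Gamma$ is the total space of a $\mathbb{T}^2$-bundle over the Inoue surface and its first Betti number is $b_1(M^6)=1$.
   Context: The group. $S_{1,\frac{\pi}{2}}$ is the simply-connected solvable Lie group whose Lie algebra has a basis of left-invariant 1-forms $e^1,\dots,e^6$ with structure equations $$de^1=e^1\wedge e^2,\quad de^2=0,\quad de^3=\tfrac12 e^2\wedge e^3,\quad de^4=\tfrac12 e^2\wedge e^4,\quad de^5=\tfrac{\pi}{2}e^2\wedge e^6,\quad de^6=-\tfrac{\pi}{2}e^2\wedge e^5.$$ The subgroup $\Gamma$ and the manifold $M^6$. Let $(m_{jk})\in SL(3,\mathbb{Z})$ be a matrix with two complex conjugate (non-real) eigenvalues $\alpha,\overline{\alpha}$ and an irrational eigenvalue $c>1$ such that $|\alpha|^2c=1$. Let $(\alpha_1,\alpha_2,\alpha_3)$ be an eigenvector corresponding to $\alpha$ and $(c_1,c_2,c_3)$ a real eigenvector corresponding to $c$, so that $(c\,c_j,\alpha\,\alpha_j)=\sum_{k=1}^3 m_{jk}(c_k,\alpha_k)$ for $j=1,2,3$; the vectors $(c_j,\alpha_j)$ are linearly independent over $\mathbb{R}$. The group $S_{1,\frac{\pi}{2}}$ is taken to be isomorphic to, and is identified with, $\mathbb{R}^6=\mathbb{R}\ltimes(\mathbb{R}\times\mathbb{C}\times\mathbb{C})$ with product $$(t,u,z,w)*(t',u',z',w')=(t+t',\,c^tu'+u,\,\alpha^tz'+z,\,e^{i\frac{\pi}{2}t}w'+w).$$ Under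 this identification $\Gamma\cong\mathbb{Z}\ltimes(\mathbb{Z}^3\times\mathbb{Z}^2)$ is the uniform discrete subgroup of $S_{1,\frac{\pi}{2}}$ generated by the transformations $$g_0:(t,u,z,w)\mapsto(t+1,cu,\alpha z,iw),\qquad g_j:(t,u,z,w)\mapsto(t,u+c_j,z+\alpha_j,w)\ (j=1,2,3),$$ $$g_4:(t,u,z,w)\mapsto(t,u,z,w+1),\qquad g_5:(t,u,z,w)\mapsto(t,u,z,w+i),$$ and $M^6=S_{1,\frac{\pi}{2}}/\Gamma$ is the compact quotient. The Inoue surface (of type $S^0$) is described as the compact quotient $M^4$ of $\mathbb{R}\ltimes(\mathbb{R}\times\mathbb{C})$, with product $(t,u,z)\cdot(t',u',z')=(t+t',c^tu'+u,\alpha^tz'+z)$, by the uniform discrete subgroup generated by $h_0:(t,u,z)\mapsto(t+1,cu,\alpha z)$ and $h_j:(t,u,z)\mapsto(t,u+c_j,z+\alpha_j)$, $j=1,2,3$. $\mathbb{T}^2$ is the 2-dimensional torus. *)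

theory Defs
  imports "HOL-Analysis.Analysis" "HOL-Homology.Homology" "HOL-Library.Extended_Nat"
begin

section \<open>Smooth maps between open subsets of Euclidean spaces\<close>

text \<open>The predicates below are only meant for open \<open>S\<close>.\<close>

primrec Ck_on ::
  "nat \<Rightarrow> 'a::euclidean_space set \<Rightarrow> ('a \<Rightarrow> 'b::euclidean_space) \<Rightarrow> bool" where
  "Ck_on 0 S f \<longleftrightarrow> continuous_on S f"
| "Ck_on (Suc k) S f \<longleftrightarrow>
     f differentiable_on S \<and> (\<forall>v. Ck_on k S (\<lambda>x. frechet_derivative f (at x) v))"

definition smooth_on ::
  "'a::euclidean_space set \<Rightarrow> ('a \<Rightarrow> 'b::euclidean_space) \<Rightarrow> bool" where
  "smooth_on S f \<longleftrightarrow> (\<forall>k. Ck_on k S f)"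


section \<open>Smooth manifolds given by a topology and an atlas\<close>

type_synonym ('a, 'e) chart = "'a set \<times> ('a \<Rightarrow> 'e)"

definition chart_on :: "'a topology \<Rightarrow> ('a, 'e::euclidean_space) chart \<Rightarrow> bool" where
  "chart_on X = (\<lambda>(U, \<phi>). openin X U \<and> open (\<phi> ` U) \<and>
     homeomorphic_map (subtopology X U) (top_of_set (\<phi> ` U)) \<phi>)"

definition smooth_manifold ::
  "'a topology \<Rightarrow> ('a, 'e::euclidean_space) chart set \<Rightarrow> bool" where
  "smooth_manifold X A \<longleftrightarrow>
     Hausdorff_space X \<and> second_countable X \<and>
     (\<forall>c\<in>A. chart_on X c) \<and> (\<Union>(U, \<phi>)\<in>A. U) = topspace X \<and>
     (\<forall>(U, \<phi>)\<in>A. \<forall>(V, \<psi>)\<in>A. smooth_on (\<phi> ` (U \<inter> V)) (\<psi> \<circ> inv_into U \<phi>))"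

definition smooth_map_on ::
  "'a topology \<Rightarrow> ('a, 'e::euclidean_space) chart set \<Rightarrow>
   'b topology \<Rightarrow> ('b, 'f::euclidean_space) chart set \<Rightarrow>
   'a set \<Rightarrow> ('a \<Rightarrow> 'b) \<Rightarrow> bool" where
  "smooth_map_on X A Y B W f \<longleftrightarrow>
     openin X W \<and> continuous_map (subtopology X W) Y f \<and>
     (\<forall>(U, \<phi>)\<in>A. \<forall>(V, \<psi>)\<in>B.
        smooth_on (\<phi> ` {x \<in> U \<inter> W. f x \<in> V}) (\<psi> \<circ> f \<circ> inv_into U \<phi>))"

definition prod_atlas ::
  "('a, 'e::euclidean_space) chart set \<Rightarrow> ('b, 'f::euclidean_space) chart set \<Rightarrow>
   ('a \<times> 'b, 'e \<times> 'f) chart set" where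
  "prod_atlas A B = {(U \<times> V, map_prod \<phi> \<psi>) |U \<phi> V \<psi>. (U, \<phi>) \<in> A \<and> (V, \<psi>) \<in> B}"

definition smooth_fibre_bundle ::
  "'a topology \<Rightarrow> ('a, 'e::euclidean_space) chart set \<Rightarrow>
   'b topology \<Rightarrow> ('b, 'f::euclidean_space) chart set \<Rightarrow>
   'c topology \<Rightarrow> ('c, 'g::euclidean_space) chart set \<Rightarrow> ('a \<Rightarrow> 'b) \<Rightarrow> bool" where
  "smooth_fibre_bundle X AX B AB F AF p \<longleftrightarrow>
     smooth_manifold X AX \<and> smooth_manifold B AB \<and> smooth_manifold F AF \<and>
     smooth_map_on X AX B AB (topspace X) p \<and> p ` topspace X = topspace B \<and>
     (\<forall>b\<in>topspace B. \<exists>U h k.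
        openin B U \<and> b \<in> U \<and>
        (let P = {x \<in> topspace X. p x \<in> U}; Q = U \<times> topspace F in
           homeomorphic_maps (subtopology X P) (subtopology (prod_topology B F) Q) h k \<and>
           smooth_map_on X AX (prod_topology B F) (prod_atlas AB AF) P h \<and>
           smooth_map_on (prod_topology B F) (prod_atlas AB AF) X AX Q k \<and>
           (\<forall>x\<in>P. fst (h x) = p x)))"


section \<open>Quotients of Lie groups by discrete subgroups\<close>

text \<open>The quotient is taken with respect to the action of \<open>H\<close> by left translations, so its
  points are the orbits, i.e. the right cosets \<open>H #> x\<close>. The group \<open>G\<close> is assumed to have
  all of a Euclidean space as its carrier.\<close>

definition quotient_space :: "'e::euclidean_space monoid \<Rightarrow> 'e set \<Rightarrow> 'e set topology" where
  "quotient_space G H =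
     topology (\<lambda>W. W \<subseteq> rcosets\<^bsub>G\<^esub> H \<and> open {x \<in> carrier G. H #>\<^bsub>G\<^esub> x \<in> W})"

text \<open>The charts are the inverses of all restrictions of the projection to open sets on which
  it is injective.\<close>

definition quotient_atlas ::
  "'e::euclidean_space monoid \<Rightarrow> 'e set \<Rightarrow> ('e set, 'e) chart set" where
  "quotient_atlas G H =
     {((\<lambda>x. H #>\<^bsub>G\<^esub> x) ` V, inv_into V (\<lambda>x. H #>\<^bsub>G\<^esub> x)) |V.
        open V \<and> V \<subseteq> carrier G \<and> inj_on (\<lambda>x. H #>\<^bsub>G\<^esub> x) V}"

lemma istopology_quotient_space:
  fixes G :: "'e::euclidean_space monoid"
  shows "istopology (\<lambda>W. W \<subseteq> rcosets\<^bsub>G\<^esub> H \<and> open {x \<in> carrier G. H #>\<^bsub>G\<^esub> x \<in> W})"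
proof -
  have 1: "{x \<in> carrier G. H #>\<^bsub>G\<^esub> x \<in> S \<inter> T} =
      {x \<in> carrier G. H #>\<^bsub>G\<^esub> x \<in> S} \<inter> {x \<in> carrier G. H #>\<^bsub>G\<^esub> x \<in> T}" for S T
    by blast
  have 2: "{x \<in> carrier G. H #>\<^bsub>G\<^esub> x \<in> \<Union>K} =
      (\<Union>S\<in>K. {x \<in> carrier G. H #>\<^bsub>G\<^esub> x \<in> S})" for K
    by blast
  show ?thesis
    unfolding istopology_def 1 2 by blast
qed

lemma openin_quotient_space:
  "openin (quotient_space G H) W \<longleftrightarrow>
     W \<subseteq> rcosets\<^bsub>G\<^esub> H \<and> open {x \<in> carrier G. H #>\<^bsub>G\<^esub> x \<in> W}"
  unfolding quotient_space_def topology_inverse'[OF istopology_quotient_space] ..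

lemma topspace_quotient_space:
  assumes "carrier G = UNIV"
  shows "topspace (quotient_space G H) = rcosets\<^bsub>G\<^esub> H"
proof -
  have "{x \<in> carrier G. H #>\<^bsub>G\<^esub> x \<in> rcosets\<^bsub>G\<^esub> H} = UNIV"
    using assms by (auto simp: RCOSETS_def)
  then have "openin (quotient_space G H) (rcosets\<^bsub>G\<^esub> H)"
    unfolding openin_quotient_space by (metis open_UNIV order_refl)
  then show ?thesis
    by (meson openin_quotient_space openin_subset openin_topspace subset_antisym)
qed

lemma quotient_map_quotient_space:
  assumes "carrier G = UNIV"
  shows "quotient_map euclidean (quotient_space G H) (\<lambda>x. H #>\<^bsub>G\<^esub> x)"
  unfolding quotient_map_def topspace_quotient_space[OF assms] openin_quotient_space
  using assms by (auto simp: RCOSETS_def)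


section \<open>The Inoue surface\<close>

text \<open>Complex powers use the principal branch of the logarithm. Only integer exponents
  occur in the subgroups, so the quotients do not depend on this choice.\<close>

definition inoue_group :: "real \<Rightarrow> complex \<Rightarrow> (real \<times> real \<times> complex) monoid" where
  "inoue_group c \<alpha> =
     \<lparr>carrier = UNIV,
      monoid.mult = (\<lambda>(t, u, z) (t', u', z').
        (t + t', c powr t * u' + u, \<alpha> powr of_real t * z' + z)),
      one = (0, 0, 0)\<rparr>"

definition inoue_lattice ::
  "real \<Rightarrow> complex \<Rightarrow> real^3 \<Rightarrow> complex^3 \<Rightarrow> (real \<times> real \<times> complex) set" where
  "inoue_lattice c \<alpha> cv av =
     generate (inoue_group c \<alpha>) ({(1, 0, 0)} \<union> range (\<lambda>j. (0, cv $ j, av $ j)))"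

abbreviation "inoue_surface c \<alpha> cv av \<equiv>
  quotient_space (inoue_group c \<alpha>) (inoue_lattice c \<alpha> cv av)"

abbreviation "inoue_atlas c \<alpha> cv av \<equiv>
  quotient_atlas (inoue_group c \<alpha>) (inoue_lattice c \<alpha> cv av)"


section \<open>The six-dimensional solvmanifold\<close>

definition S_group :: "real \<Rightarrow> complex \<Rightarrow> (real \<times> real \<times> complex \<times> complex) monoid" where
  "S_group c \<alpha> =
     \<lparr>carrier = UNIV,
      monoid.mult = (\<lambda>(t, u, z, w) (t', u', z', w').
        (t + t', c powr t * u' + u, \<alpha> powr of_real t * z' + z,
         exp (\<i> * of_real (pi / 2) * of_real t) * w' + w)),
      one = (0, 0, 0, 0)\<rparr>"

definition \<Gamma>_lattice ::
  "real \<Rightarrow> complex \<Rightarrow> real^3 \<Rightarrow> complex^3 \<Rightarrow> (real \<times> real \<times> complex \<times> complex) set" where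
  "\<Gamma>_lattice c \<alpha> cv av =
     generate (S_group c \<alpha>)
       ({(1, 0, 0, 0)} \<union> range (\<lambda>j. (0, cv $ j, av $ j, 0)) \<union> {(0, 0, 0, 1), (0, 0, 0, \<i>)})"

abbreviation "M6 c \<alpha> cv av \<equiv> quotient_space (S_group c \<alpha>) (\<Gamma>_lattice c \<alpha> cv av)"

abbreviation "M6_atlas c \<alpha> cv av \<equiv> quotient_atlas (S_group c \<alpha>) (\<Gamma>_lattice c \<alpha> cv av)"

text \<open>The generating transformations \<open>g\<^sub>0, \<dots>, g\<^sub>5\<close> (and \<open>h\<^sub>0, \<dots>, h\<^sub>3\<close>)
  are the left translations by the generators used above.\<close>

lemma inoue_left_translations:
  assumes "c > 0" "\<alpha> \<noteq> 0"
  shows "(1, 0, 0) \<otimes>\<^bsub>inoue_group c \<alpha>\<^esub> (t, u, z) = (t + 1, c * u, \<alpha> * z)"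
    and "(0, a, b) \<otimes>\<^bsub>inoue_group c \<alpha>\<^esub> (t, u, z) = (t, u + a, z + b)"
  using assms by (simp_all add: inoue_group_def powr_def)

lemma S_left_translations:
  assumes "c > 0" "\<alpha> \<noteq> 0"
  shows "(1, 0, 0, 0) \<otimes>\<^bsub>S_group c \<alpha>\<^esub> (t, u, z, w) = (t + 1, c * u, \<alpha> * z, \<i> * w)"
    and "(0, a, b, 0) \<otimes>\<^bsub>S_group c \<alpha>\<^esub> (t, u, z, w) = (t, u + a, z + b, w)"
    and "(0, 0, 0, d) \<otimes>\<^bsub>S_group c \<alpha>\<^esub> (t, u, z, w) = (t, u, z, w + d)"
  using assms exp_pi_i' cis_conv_exp[of "pi / 2"]
  by (simp_all add: S_group_def powr_def mult.commute)

lemma group_inoue_group: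
  assumes "c > 0" "\<alpha> \<noteq> 0"
  shows "group (inoue_group c \<alpha>)"
proof (rule groupI)
  fix x assume "x \<in> carrier (inoue_group c \<alpha>)"
  obtain t u z where x: "x = (t, u, z)" by (metis prod_cases3)
  have "(-t, -(c powr (-t) * u), -(\<alpha> powr of_real (-t) * z)) \<otimes>\<^bsub>inoue_group c \<alpha>\<^esub> x
      = \<one>\<^bsub>inoue_group c \<alpha>\<^esub>"
    by (simp add: inoue_group_def x)
  then show "\<exists>y\<in>carrier (inoue_group c \<alpha>). y \<otimes>\<^bsub>inoue_group c \<alpha>\<^esub> x = \<one>\<^bsub>inoue_group c \<alpha>\<^esub>"
    by (metis (no_types, lifting) UNIV_I inoue_group_def partial_object.select_convs(1))
qed (use assms in \<open>auto simp: inoue_group_def powr_add algebra_simps\<close>)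

lemma group_S_group:
  assumes "c > 0" "\<alpha> \<noteq> 0"
  shows "group (S_group c \<alpha>)"
proof (rule groupI)
  fix x assume "x \<in> carrier (S_group c \<alpha>)"
  obtain t u z w where x: "x = (t, u, z, w)" by (metis prod_cases4)
  have "(-t, -(c powr (-t) * u), -(\<alpha> powr of_real (-t) * z),
          -(exp (\<i> * of_real (pi / 2) * of_real (-t)) * w)) \<otimes>\<^bsub>S_group c \<alpha>\<^esub> x
      = \<one>\<^bsub>S_group c \<alpha>\<^esub>"
    by (simp add: S_group_def x)
  then show "\<exists>y\<in>carrier (S_group c \<alpha>). y \<otimes>\<^bsub>S_group c \<alpha>\<^esub> x = \<one>\<^bsub>S_group c \<alpha>\<^esub>"
    by (metis (no_types, lifting) UNIV_I S_group_def partial_object.select_convs(1))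
qed (use assms in \<open>auto simp: S_group_def powr_add exp_add algebra_simps add_divide_distrib\<close>)


section \<open>The torus\<close>

definition complex_add_group :: "complex monoid" where
  "complex_add_group = \<lparr>carrier = UNIV, monoid.mult = (+), one = 0\<rparr>"

definition gauss_lattice :: "complex set" where
  "gauss_lattice = {of_int k + \<i> * of_int l |k l. True}"

abbreviation "torus2 \<equiv> quotient_space complex_add_group gauss_lattice"

abbreviation "torus2_atlas \<equiv> quotient_atlas complex_add_group gauss_lattice"


section \<open>Betti numbers\<close>

definition int_independent :: "('a, 'm) monoid_scheme \<Rightarrow> 'a set \<Rightarrow> bool" where
  "int_independent G B \<longleftrightarrow>
     (\<forall>k::'a \<Rightarrow> int. (\<Otimes>\<^bsub>G\<^esub>b\<in>B. b [^]\<^bsub>G\<^esub> k b) = \<one>\<^bsub>G\<^esub> \<longrightarrow> (\<forall>b\<in>B. k b = 0))"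

definition abelian_rank :: "('a, 'm) monoid_scheme \<Rightarrow> enat" where
  "abelian_rank G = (SUP B \<in> {B. finite B \<and> B \<subseteq> carrier G \<and> int_independent G B}. enat (card B))"

definition betti_number :: "nat \<Rightarrow> 'a topology \<Rightarrow> enat" where
  "betti_number p X = abelian_rank (homology_group (int p) X)"

end

theory Submission
  imports Defs
begin

text \<open>All left translations of \<open>\<real>\<^sup>6\<close> by \<open>\<Gamma>\<close> are affine, so every map occurring below is
  affine in suitable charts and smoothness is automatic. Forgetting the coordinate \<open>w\<close> maps
  \<open>\<Gamma>\<close> onto the group of the Inoue surface with kernel \<open>\<int>[\<i>]\<close>; over an evenly covered open set
  \<open>V\<close> of the Inoue surface the bundle is the image of \<open>V \<times> \<complex>\<close>, that is \<open>V \<times> \<complex>/\<int>[\<i>]\<close>.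

  A sufficiently subdivided singular 1-cycle lifts simplex by simplex to \<open>\<real>\<^sup>6\<close>. Straightening
  the lifts shows that it is homologous to the projection of one segment from \<open>1\<close> to some
  \<open>\<gamma> \<in> \<Gamma>\<close>, so \<open>H\<^sub>1\<close> is a quotient of \<open>\<Gamma>\<close>. Conjugation by \<open>g\<^sub>0\<close> acts on \<open>\<int>\<^sup>3\<close> as \<open>m\<close> and
  on \<open>\<int>[\<i>]\<close> as multiplication by \<open>\<i>\<close>, so in \<open>H\<^sub>1\<close> the classes of these translations are killed
  by \<open>det (m - 1) \<noteq> 0\<close> and by \<open>2\<close>. The class of \<open>g\<^sub>0\<close> has infinite order because the increment
  of the logarithm of \<open>exp (2 \<pi> \<i> t)\<close> along 1-simplices vanishes on boundaries.\<close>

section \<open>Manifolds with locally affine charts\<close>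

text \<open>Fixing the left factor makes the product affine in the right one, since the powers and
  exponentials involve only the first coordinate of the left factor. The charts invert the
  projection on arbitrary, possibly disconnected open sets, so a change of charts is a left
  translation whose group element may vary from piece to piece; hence the class of locally affine
  maps.

  In degree one the obstacle is that the lift of a simplex, and even of a point, is determined only
  up to the group. Lifts of points are therefore chosen once and for all; comparing an edge with the
  chosen lifts of its endpoints leaves a group element and an error that depends on the boundary
  alone. The error is additive and disappears on cycles.

  The group H_1 itself is never computed. A surjection from the discrete group, a uniform exponent 2
  det(m - 1) after which every class is a power of that of g_0, and one real character with integral
  values on the group bound the rank from both sides.\<close>

definition affine_map :: "('a::real_vector \<Rightarrow> 'b::real_vector) \<Rightarrow> bool" where
  "affine_map f \<longleftrightarrow> (\<exists>L b. linear L \<and> f = (\<lambda>x. L x + b))"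

lemma affine_mapI: "linear L \<Longrightarrow> (\<And>x. f x = L x + b) \<Longrightarrow> affine_map f"
  unfolding affine_map_def by auto

lemma affine_map_linear: "linear L \<Longrightarrow> affine_map L"
  by (rule affine_mapI[where b = 0]) auto

lemma affine_map_compose:
  assumes "affine_map f" "affine_map g"
  shows "affine_map (\<lambda>x. g (f x))"
proof -
  obtain L b M d where "linear L" "f = (\<lambda>x. L x + b)" "linear M" "g = (\<lambda>x. M x + d)"
    using assms unfolding affine_map_def by auto
  then show ?thesis
    by (intro affine_mapI[of "M \<circ> L" _ "M b + d"] linear_compose) (auto simp: linear_add)
qed

lemma affine_map_Pair:
  assumes "affine_map f" "affine_map g"
  shows "affine_map (\<lambda>x. (f x, g x))"
proof -
  obtain L b M d where *: "linear L" "f = (\<lambda>x. L x + b)" "linear M" "g = (\<lambda>x. M x + d)"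
    using assms unfolding affine_map_def by auto
  have "linear (\<lambda>x. (L x, M x))"
    using * by (auto intro!: linearI simp: linear_add linear_scale)
  then show ?thesis
    by (rule affine_mapI[of _ _ "(b, d)"]) (auto simp: *)
qed

lemma continuous_on_affine_map:
  fixes f :: "'a::euclidean_space \<Rightarrow> 'b::real_normed_vector"
  assumes "affine_map f"
  shows "continuous_on S f"
proof -
  obtain L b where "linear L" "f = (\<lambda>x. L x + b)"
    using assms unfolding affine_map_def by auto
  then show ?thesis
    by (simp add: linear_continuous_on linear_linear continuous_on_add)
qed

text \<open>Asking for \<open>T \<subseteq> S\<close> makes \<open>S\<close> open, so derivatives
  inside \<open>S\<close> are the ordinary ones, as \<open>Ck_on\<close> expects.\<close>

definition locally_affine_on ::
  "'a::euclidean_space set \<Rightarrow> ('a \<Rightarrow> 'b::euclidean_space) \<Rightarrow> bool" where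
  "locally_affine_on S f \<longleftrightarrow>
     (\<forall>x\<in>S. \<exists>T g. open T \<and> x \<in> T \<and> T \<subseteq> S \<and> affine_map g \<and> (\<forall>y\<in>T. f y = g y))"

text \<open>The derivative of a locally affine map in a fixed direction is locally constant, hence
  again locally affine, and the induction closes within this class.\<close>

lemma locally_affine_imp_Ck_on: "locally_affine_on S f \<Longrightarrow> Ck_on k S f"
proof (induction k arbitrary: f)
  case 0
  have "isCont f x" if x: "x \<in> S" for x
  proof -
    obtain T g where T: "open T" "x \<in> T" "affine_map g" "\<forall>y\<in>T. f y = g y"
      using 0[unfolded locally_affine_on_def, rule_format, OF x] by blast
    have "isCont g x"
      using continuous_on_affine_map[OF T(3), of UNIV] by (simp add: continuous_on_eq_continuous_at)
    moreover have "\<forall>\<^sub>F y in nhds x. f y = g y"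
      using T eventually_nhds by blast
    ultimately show ?thesis
      by (simp add: isCont_cong)
  qed
  then show ?case
    by (simp add: continuous_at_imp_continuous_on)
next
  case (Suc k)
  have loc: "\<exists>T L. open T \<and> x \<in> T \<and> T \<subseteq> S \<and> linear L \<and> (\<forall>y\<in>T. (f has_derivative L) (at y))"
    if "x \<in> S" for x
  proof -
    obtain T g where T: "open T" "x \<in> T" "T \<subseteq> S" "affine_map g" "\<forall>y\<in>T. f y = g y"
      using Suc.prems[unfolded locally_affine_on_def, rule_format, OF \<open>x \<in> S\<close>] by blast
    obtain L b where L: "linear L" "g = (\<lambda>x. L x + b)"
      using T(4) unfolding affine_map_def by auto
    have "(f has_derivative L) (at y)" if "y \<in> T" for y
    proof -
      have "(g has_derivative L) (at y)"
        using linear_imp_has_derivative[OF L(1)] unfolding L(2)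
        by (simp add: has_derivative_add_const)
      then show ?thesis
        using T that by (metis has_derivative_transform_within_open)
    qed
    then show ?thesis
      using T L by blast
  qed
  have "f differentiable_on S"
    unfolding differentiable_on_def
  proof
    fix x assume "x \<in> S"
    then obtain T L where "x \<in> T" "\<forall>y\<in>T. (f has_derivative L) (at y)"
      using loc by blast
    then have "f differentiable at x"
      unfolding differentiable_def by blast
    then show "f differentiable at x within S"
      by (rule differentiable_at_withinI)
  qed
  moreover have "locally_affine_on S (\<lambda>x. frechet_derivative f (at x) v)" for v
    unfolding locally_affine_on_def
  proof
    fix x assume "x \<in> S"
    then obtain T L where T: "open T" "x \<in> T" "T \<subseteq> S" "linear L"
        "\<forall>y\<in>T. (f has_derivative L) (at y)"
      using loc by blast
    have "affine_map (\<lambda>x::'a. L v)"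
      by (rule affine_mapI[where L = "\<lambda>x. 0"]) (auto intro: linear_zero)
    moreover have "\<forall>y\<in>T. frechet_derivative f (at y) v = L v"
      using T frechet_derivative_at by metis
    ultimately show "\<exists>T g. open T \<and> x \<in> T \<and> T \<subseteq> S \<and> affine_map g \<and>
        (\<forall>y\<in>T. frechet_derivative f (at y) v = g y)"
      using T by blast
  qed
  ultimately show ?case
    using Suc.IH by simp
qed

lemma locally_affine_imp_smooth_on: "locally_affine_on S f \<Longrightarrow> smooth_on S f"
  by (simp add: locally_affine_imp_Ck_on smooth_on_def)

text \<open>A presentation of a manifold as a quotient of a Euclidean space by a local homeomorphism
  that becomes affine in every chart.\<close>

definition affine_cover ::
  "'a topology \<Rightarrow> ('a, 'e::euclidean_space) chart set \<Rightarrow> ('e \<Rightarrow> 'a) \<Rightarrow> bool" where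
  "affine_cover X A q \<longleftrightarrow>
     continuous_map euclidean X q \<and> open_map euclidean X q \<and> range q = topspace X \<and>
     (\<forall>(U, \<phi>)\<in>A. openin X U \<and> open (\<phi> ` U) \<and> (\<forall>a\<in>U. q (\<phi> a) = a) \<and>
        (\<forall>x. q x \<in> U \<longrightarrow> (\<exists>T g. open T \<and> x \<in> T \<and> affine_map g \<and>
           (\<forall>y\<in>T. q y \<in> U \<and> \<phi> (q y) = g y))))"

section \<open>Lifting criteria for continuity and smoothness\<close>

lemma affine_cover_chartD:
  assumes "affine_cover X A q" "(U, \<phi>) \<in> A"
  shows "openin X U" "open (\<phi> ` U)" "\<And>a. a \<in> U \<Longrightarrow> q (\<phi> a) = a"
    and "\<And>x. q x \<in> U \<Longrightarrow> \<exists>T g. open T \<and> x \<in> T \<and> affine_map g \<and>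
           (\<forall>y\<in>T. q y \<in> U \<and> \<phi> (q y) = g y)"
  using assms unfolding affine_cover_def by auto

text \<open>Openness of \<open>q\<close> turns a neighbourhood upstairs into one downstairs, so
  continuity can be tested on local lifts. The equation is asked only where
  \<open>q y \<in> W\<close>, because \<open>T\<close> may leave the preimage of
  \<open>W\<close>.\<close>

lemma continuous_map_locally_lifted:
  fixes q :: "'e::topological_space \<Rightarrow> 'a"
  assumes q: "open_map euclidean X q" "range q = topspace X"
    and W: "W \<subseteq> topspace X"
    and loc: "\<And>x. q x \<in> W \<Longrightarrow> \<exists>T g. open T \<and> x \<in> T \<and> continuous_map (top_of_set T) Y g \<and>
                (\<forall>y\<in>T. q y \<in> W \<longrightarrow> f (q y) = g y)"
  shows "continuous_map (subtopology X W) Y f"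
  unfolding continuous_map_def
proof (intro conjI allI impI)
  show "f \<in> topspace (subtopology X W) \<rightarrow> topspace Y"
  proof
    fix a assume "a \<in> topspace (subtopology X W)"
    then obtain x where x: "a = q x" "q x \<in> W"
      using W q by (metis IntD2 imageE subsetD topspace_subtopology)
    then show "f a \<in> topspace Y"
      using loc[OF x(2)] by (force simp: continuous_map_def)
  qed
  fix V assume V: "openin Y V"
  let ?P = "{a \<in> topspace (subtopology X W). f a \<in> V}"
  show "openin (subtopology X W) ?P"
  proof (subst openin_subopen, intro ballI)
    fix a assume a: "a \<in> ?P"
    then have "a \<in> W" by auto
    then obtain x where x: "a = q x" "q x \<in> W"
      using W q by (metis imageE subsetD)
    obtain T g where T: "open T" "x \<in> T" "continuous_map (top_of_set T) Y g"
        "\<forall>y\<in>T. q y \<in> W \<longrightarrow> f (q y) = g y"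
      using loc[OF x(2)] by blast
    let ?O = "{y \<in> T. g y \<in> V}"
    have "openin (top_of_set T) ?O"
      using T(3) V by (auto simp: continuous_map_def)
    then have "open ?O"
      using T(1) openin_open_eq by blast
    then have "openin X (q ` ?O)"
      using q(1) by (simp add: open_map_def)
    then have "openin (subtopology X W) (q ` ?O \<inter> W)"
      by (auto simp: openin_subtopology)
    moreover have "a \<in> q ` ?O \<inter> W"
      using a x T by auto
    moreover have "q ` ?O \<inter> W \<subseteq> ?P"
      using T W by auto
    ultimately show "\<exists>S. openin (subtopology X W) S \<and> a \<in> S \<and> S \<subseteq> ?P"
      by blast
  qed
qed

lemma affine_cover_chart_on:
  assumes "affine_cover X A q" "(U, \<phi>) \<in> A"
  shows "chart_on X (U, \<phi>)"
proof -
  note c = affine_cover_chartD[OF assms]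
  have q: "continuous_map euclidean X q" "open_map euclidean X q" "range q = topspace X"
    using assms by (auto simp: affine_cover_def)
  have "continuous_map (subtopology X U) euclidean \<phi>"
  proof (rule continuous_map_locally_lifted[OF q(2,3)])
    show "U \<subseteq> topspace X"
      using c(1) by (rule openin_subset)
    fix x assume "q x \<in> U"
    then obtain T g where "open T" "x \<in> T" "affine_map g" "\<forall>y\<in>T. q y \<in> U \<and> \<phi> (q y) = g y"
      using c(4) by blast
    then show "\<exists>T g. open T \<and> x \<in> T \<and> continuous_map (top_of_set T) euclidean g \<and>
        (\<forall>y\<in>T. q y \<in> U \<longrightarrow> \<phi> (q y) = g y)"
      by (metis continuous_on_affine_map continuous_map_iff_continuous)
  qed
  then have "continuous_map (subtopology X U) (top_of_set (\<phi> ` U)) \<phi>"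
    using openin_subset[OF c(1)] by (simp add: continuous_map_in_subtopology)
  moreover have "continuous_map (top_of_set (\<phi> ` U)) (subtopology X U) q"
    using q(1) c(3) by (auto simp: continuous_map_in_subtopology continuous_map_from_subtopology)
  ultimately have "homeomorphic_maps (subtopology X U) (top_of_set (\<phi> ` U)) \<phi> q"
    using openin_subset[OF c(1)] c(3) by (auto simp: homeomorphic_maps_def)
  then show ?thesis
    using c by (auto simp: chart_on_def homeomorphic_map_maps)
qed

lemma affine_cover_inv_chart:
  assumes "affine_cover X A q" "(U, \<phi>) \<in> A" "y \<in> \<phi> ` U"
  shows "inv_into U \<phi> y = q y"
proof -
  note c = affine_cover_chartD[OF assms(1,2)]
  have "inj_on \<phi> U"
    by (rule inj_on_inverseI[of _ q]) (rule c(3))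
  then show ?thesis
    using assms(3) c(3) by auto
qed

text \<open>Since \<open>inv_into U \<phi>\<close> agrees with \<open>q\<close>, the coordinate
  expression of \<open>f\<close> is \<open>\<psi>\<close> after \<open>r\<close> after the lift
  \<open>g\<close>, and \<open>\<psi>\<close> after \<open>r\<close> is locally affine by the affine
  cover of \<open>Y\<close>.\<close>

lemma smooth_map_on_locally_affine_lift:
  assumes X: "affine_cover X A q" and Y: "affine_cover Y B r" and W: "openin X W"
    and loc: "\<And>x. q x \<in> W \<Longrightarrow> \<exists>T g. open T \<and> x \<in> T \<and> affine_map g \<and>
                (\<forall>y\<in>T. q y \<in> W \<longrightarrow> f (q y) = r (g y))"
  shows "smooth_map_on X A Y B W f"
  unfolding smooth_map_on_def
proof (intro conjI, rule W)
  have q: "continuous_map euclidean X q" "open_map euclidean X q" "range q = topspace X"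
    and r: "continuous_map euclidean Y r"
    using X Y by (auto simp: affine_cover_def)
  show "continuous_map (subtopology X W) Y f"
  proof (rule continuous_map_locally_lifted[OF q(2,3)])
    show "W \<subseteq> topspace X"
      using W by (rule openin_subset)
    fix x assume "q x \<in> W"
    then obtain T g where T: "open T" "x \<in> T" "affine_map g" "\<forall>y\<in>T. q y \<in> W \<longrightarrow> f (q y) = r (g y)"
      using loc by blast
    have "continuous_map (top_of_set T) Y (r \<circ> g)"
      using continuous_on_affine_map[OF T(3), of T] r
      by (intro continuous_map_compose[of _ euclidean]) auto
    then show "\<exists>T g. open T \<and> x \<in> T \<and> continuous_map (top_of_set T) Y g \<and>
        (\<forall>y\<in>T. q y \<in> W \<longrightarrow> f (q y) = g y)"
      using T by (metis comp_apply)
  qed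
  have "smooth_on (\<phi> ` {x \<in> U \<inter> W. f x \<in> V}) (\<psi> \<circ> f \<circ> inv_into U \<phi>)"
    if c: "(U, \<phi>) \<in> A" and d: "(V, \<psi>) \<in> B" for U \<phi> V \<psi>
  proof (rule locally_affine_imp_smooth_on)
    note C = affine_cover_chartD[OF X c] and D = affine_cover_chartD[OF Y d]
    let ?S = "\<phi> ` {x \<in> U \<inter> W. f x \<in> V}"
    have oW: "open {y. q y \<in> W}"
      using q(1) W by (auto simp: continuous_map_def)
    show "locally_affine_on ?S (\<psi> \<circ> f \<circ> inv_into U \<phi>)"
      unfolding locally_affine_on_def
    proof
      fix x assume x: "x \<in> ?S"
      then have xU: "x \<in> \<phi> ` U" and qx: "q x \<in> W" "f (q x) \<in> V"
        using C(3) by auto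
      obtain T g where T: "open T" "x \<in> T" "affine_map g" "\<forall>y\<in>T. q y \<in> W \<longrightarrow> f (q y) = r (g y)"
        using loc[OF qx(1)] by blast
      have "r (g x) \<in> V"
        using T qx by auto
      then obtain T' g' where T': "open T'" "g x \<in> T'" "affine_map g'"
          "\<forall>y\<in>T'. r y \<in> V \<and> \<psi> (r y) = g' y"
        using D(4) by blast
      have og: "open (g -` T')"
        using continuous_on_affine_map[OF T(3), of UNIV] T'(1)
        by (metis continuous_on_open_vimage open_UNIV Int_UNIV_right)
      \<comment> \<open>The four conditions say that \<open>y\<close> is a coordinate of the chart,
        lies over \<open>W\<close>, and is in reach of both affine lifts.\<close>
      let ?N = "\<phi> ` U \<inter> {y. q y \<in> W} \<inter> T \<inter> g -` T'"
      have "open ?N"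
        using C(2) oW T(1) og by blast
      moreover have "x \<in> ?N"
        using xU qx T T' by auto
      moreover have "?N \<subseteq> ?S"
      proof
        fix y assume y: "y \<in> ?N"
        then obtain a where a: "a \<in> U" "y = \<phi> a" by auto
        have "q y = a"
          using a C(3) by auto
        then show "y \<in> ?S"
          using y a T T' by auto
      qed
      moreover have "affine_map (\<lambda>y. g' (g y))"
        using T T' affine_map_compose by blast
      moreover have "(\<psi> \<circ> f \<circ> inv_into U \<phi>) y = g' (g y)" if "y \<in> ?N" for y
        using that T T' affine_cover_inv_chart[OF X c, of y] by auto
      ultimately show "\<exists>T g. open T \<and> x \<in> T \<and> T \<subseteq> ?S \<and> affine_map g \<and>
          (\<forall>y\<in>T. (\<psi> \<circ> f \<circ> inv_into U \<phi>) y = g y)"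
        by blast
    qed
  qed
  then show "\<forall>(U, \<phi>)\<in>A. \<forall>(V, \<psi>)\<in>B.
      smooth_on (\<phi> ` {x \<in> U \<inter> W. f x \<in> V}) (\<psi> \<circ> f \<circ> inv_into U \<phi>)"
    by blast
qed

text \<open>The transition maps are the coordinate expressions of the identity, which lifts to the
  identity. Second countability descends along the open continuous surjection
  \<open>q\<close>.\<close>

lemma affine_cover_smooth_manifold:
  assumes X: "affine_cover X A q" and "Hausdorff_space X" and cov: "(\<Union>(U, \<phi>)\<in>A. U) = topspace X"
  shows "smooth_manifold X A"
proof -
  have "second_countable X"
  proof (rule second_countable_open_map_image[of euclidean X q])
    obtain \<B> :: "'b set set" where "countable \<B>" "\<And>C. C \<in> \<B> \<Longrightarrow> open C"
        "\<And>S. open S \<Longrightarrow> \<exists>U. U \<subseteq> \<B> \<and> S = \<Union>U"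
      using univ_second_countable by metis
    moreover from this have "\<exists>V\<in>\<B>. x \<in> V \<and> V \<subseteq> U" if "open U" "x \<in> U" for U and x :: 'b
      using that by (metis UnionE Union_upper subset_iff)
    ultimately show "second_countable (euclidean :: 'b topology)"
      unfolding second_countable_def by (metis open_openin)
  qed (use X in \<open>auto simp: affine_cover_def\<close>)
  moreover have "smooth_on (\<phi> ` (U \<inter> V)) (\<psi> \<circ> inv_into U \<phi>)" if "(U, \<phi>) \<in> A" "(V, \<psi>) \<in> A" for U \<phi> V \<psi>
  proof -
    have "smooth_map_on X A X A (topspace X) id"
    proof (rule smooth_map_on_locally_affine_lift[OF X X])
      show "\<exists>T g. open T \<and> x \<in> T \<and> affine_map g \<and> (\<forall>y\<in>T. q y \<in> topspace X \<longrightarrow> id (q y) = q (g y))" for x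
        using affine_map_linear[OF linear_id] by (metis UNIV_I id_apply open_UNIV)
    qed auto
    then have "smooth_on (\<phi> ` {x \<in> U \<inter> topspace X. id x \<in> V}) (\<psi> \<circ> id \<circ> inv_into U \<phi>)"
      using that unfolding smooth_map_on_def by fast
    moreover have "{x \<in> U \<inter> topspace X. id x \<in> V} = U \<inter> V"
      using openin_subset[OF affine_cover_chartD(1)[OF X that(1)]] by auto
    ultimately show ?thesis by simp
  qed
  ultimately show ?thesis
    using assms affine_cover_chart_on[OF X] unfolding smooth_manifold_def by auto
qed

text \<open>Puts base times torus within reach of the same lifting criterion, which then serves the
  trivializations in both directions.\<close>

lemma affine_cover_prod:
  assumes X: "affine_cover X A q" and Y: "affine_cover Y B r"
  shows "affine_cover (prod_topology X Y) (prod_atlas A B) (map_prod q r)"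
  unfolding affine_cover_def
proof (intro conjI ballI)
  have q: "continuous_map euclidean X q" "open_map euclidean X q" "range q = topspace X"
    and r: "continuous_map euclidean Y r" "open_map euclidean Y r" "range r = topspace Y"
    using X Y by (auto simp: affine_cover_def)
  have eq: "(euclidean :: ('b \<times> 'd) topology) = prod_topology euclidean euclidean"
    by simp
  show "continuous_map euclidean (prod_topology X Y) (map_prod q r)"
    unfolding eq map_prod_def using q r
    by (subst continuous_map_prod_top) auto
  show "open_map euclidean (prod_topology X Y) (map_prod q r)"
    unfolding open_map_def
  proof (intro allI impI, subst openin_subopen, intro ballI)
    fix S :: "('b \<times> 'd) set" and z
    assume "openin euclidean S" "z \<in> map_prod q r ` S"
    then obtain x y where xy: "open S" "(x, y) \<in> S" "z = (q x, r y)" by auto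
    then obtain C D where "open C" "open D" "x \<in> C" "y \<in> D" "C \<times> D \<subseteq> S"
      by (metis open_prod_elim mem_Sigma_iff)
    then have "openin (prod_topology X Y) (q ` C \<times> r ` D)" "z \<in> q ` C \<times> r ` D"
      "q ` C \<times> r ` D \<subseteq> map_prod q r ` S"
      using q r xy by (auto simp: openin_prod_Times_iff open_map_def)
    then show "\<exists>T. openin (prod_topology X Y) T \<and> z \<in> T \<and> T \<subseteq> map_prod q r ` S"
      by blast
  qed
  show "range (map_prod q r) = topspace (prod_topology X Y)"
    using q r by (auto simp: map_prod_surj_on[of q UNIV _ r UNIV, simplified])
  fix c assume "c \<in> prod_atlas A B"
  then obtain U \<phi> V \<psi> where c: "c = (U \<times> V, map_prod \<phi> \<psi>)" "(U, \<phi>) \<in> A" "(V, \<psi>) \<in> B"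
    unfolding prod_atlas_def by auto
  note C = affine_cover_chartD[OF X c(2)] and D = affine_cover_chartD[OF Y c(3)]
  have "map_prod \<phi> \<psi> ` (U \<times> V) = \<phi> ` U \<times> \<psi> ` V"
    by (auto simp: map_prod_surj_on)
  then have "open (map_prod \<phi> \<psi> ` (U \<times> V))"
    using C D by (simp add: open_Times)
  moreover have "openin (prod_topology X Y) (U \<times> V)"
    using C D by (simp add: openin_prod_Times_iff)
  moreover have "\<exists>T g. open T \<and> x \<in> T \<and> affine_map g \<and>
      (\<forall>y\<in>T. map_prod q r y \<in> U \<times> V \<and> map_prod \<phi> \<psi> (map_prod q r y) = g y)"
    if x: "map_prod q r x \<in> U \<times> V" for x
  proof -
    obtain x1 x2 where x12: "x = (x1, x2)" by fastforce
    obtain T g where T: "open T" "x1 \<in> T" "affine_map g" "\<forall>y\<in>T. q y \<in> U \<and> \<phi> (q y) = g y"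
      using C(4)[of x1] x unfolding x12 by auto
    obtain T' g' where T': "open T'" "x2 \<in> T'" "affine_map g'" "\<forall>y\<in>T'. r y \<in> V \<and> \<psi> (r y) = g' y"
      using D(4)[of x2] x unfolding x12 by auto
    have "affine_map (\<lambda>y. (g (fst y), g' (snd y)))"
      by (intro affine_map_Pair affine_map_compose[OF affine_map_linear[OF linear_fst] T(3)]
         affine_map_compose[OF affine_map_linear[OF linear_snd] T'(3)])
    then show ?thesis
      using T T' x12 by (intro exI[of _ "T \<times> T'"] exI[of _ "\<lambda>y. (g (fst y), g' (snd y))"])
        (auto simp: open_Times)
  qed
  ultimately show "case c of (U, \<phi>) \<Rightarrow> openin (prod_topology X Y) U \<and> open (\<phi> ` U) \<and>
      (\<forall>a\<in>U. map_prod q r (\<phi> a) = a) \<and>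
      (\<forall>x. map_prod q r x \<in> U \<longrightarrow> (\<exists>T g. open T \<and> x \<in> T \<and> affine_map g \<and>
           (\<forall>y\<in>T. map_prod q r y \<in> U \<and> \<phi> (map_prod q r y) = g y)))"
    using C D unfolding c by auto
qed

section \<open>Quotients by discrete groups of affine left translations\<close>

text \<open>Joint multiplication and inversion are asked to be continuous only, because in the
  solvable groups they involve exponentials of the first coordinate and are not affine.\<close>

locale discrete_affine_subgroup = group G for G :: "'e::euclidean_space monoid" (structure) +
  fixes H :: "'e set"
  assumes carrier_UNIV: "carrier G = UNIV"
    and subgroup: "subgroup H G"
    and continuous_mult: "continuous_on UNIV (\<lambda>(x, y). x \<otimes> y)"
    and continuous_inv: "continuous_on UNIV (m_inv G)"
    and affine_left_mult: "affine_map (\<lambda>x. g \<otimes> x)"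
    and discrete: "\<exists>U. open U \<and> U \<inter> H = {\<one>}"
begin

abbreviation "proj \<equiv> (\<lambda>x. H #> x)"

abbreviation "quot \<equiv> quotient_space G H"

lemma in_carrier [simp]: "x \<in> carrier G"
  by (simp add: carrier_UNIV)

lemma proj_eq_iff: "proj x = proj y \<longleftrightarrow> (\<exists>h\<in>H. y = h \<otimes> x)"
proof
  assume "proj x = proj y"
  then have "y \<in> proj x"
    using subgroup by (simp add: rcos_self)
  then show "\<exists>h\<in>H. y = h \<otimes> x"
    by (auto simp: r_coset_def)
next
  assume "\<exists>h\<in>H. y = h \<otimes> x"
  then have "y \<in> proj x"
    by (auto simp: r_coset_def)
  then show "proj x = proj y"
    using subgroup by (intro repr_independence) auto
qed

lemma proj_translate: "h \<in> H \<Longrightarrow> proj (h \<otimes> x) = proj x"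
  using proj_eq_iff by metis

lemma topspace_quot: "topspace quot = range proj"
  using topspace_quotient_space[OF carrier_UNIV, of H] by (auto simp: RCOSETS_def carrier_UNIV)

lemma openin_quot: "openin quot W \<longleftrightarrow> W \<subseteq> range proj \<and> open {x. proj x \<in> W}"
  unfolding openin_quotient_space by (auto simp: RCOSETS_def carrier_UNIV)

lemma continuous_proj: "continuous_map euclidean quot proj"
  using quotient_imp_continuous_map[OF quotient_map_quotient_space[OF carrier_UNIV]] .

lemma continuous_left_mult: "continuous_on S (\<lambda>x. g \<otimes> x)"
  using continuous_on_affine_map[OF affine_left_mult] .

lemma open_translate:
  assumes "open S"
  shows "open {x. g \<otimes> x \<in> S}"
  using continuous_left_mult[of UNIV g] assms by (simp add: continuous_on_open_vimage vimage_def)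

text \<open>The saturation of an open set is the union of its preimages under the left translations
  by \<open>H\<close>.\<close>

lemma open_map_proj: "open_map euclidean quot proj"
  unfolding open_map_def openin_quot
proof (intro allI impI conjI)
  fix S :: "'e set" assume "openin euclidean S"
  then have S: "open S" by simp
  have "{x. proj x \<in> proj ` S} = (\<Union>h\<in>H. {x. h \<otimes> x \<in> S})"
    unfolding image_iff proj_eq_iff by auto
  then show "open {x. proj x \<in> proj ` S}"
    using open_translate[OF S] by auto
qed auto

lemma continuous_div: "continuous_on UNIV (\<lambda>z. snd z \<otimes> inv (fst z))"
proof -
  have "continuous_on UNIV (\<lambda>z. inv (fst z :: 'e))"
    using continuous_on_compose2[OF continuous_inv continuous_on_fst[OF continuous_on_id]] by auto
  then have "continuous_on UNIV (\<lambda>z. (snd z :: 'e, inv (fst z :: 'e)))"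
    by (intro continuous_intros)
  from continuous_on_compose2[OF continuous_mult this] show ?thesis
    by simp
qed

text \<open>Separation properties of orbits become statements about the position of
  \<open>y \<otimes> inv x\<close> relative to \<open>H\<close>.\<close>

lemma div_neighbourhoods:
  assumes "open W" "y \<otimes> inv x \<in> W"
  obtains U V where "open U" "open V" "x \<in> U" "y \<in> V"
    "\<And>a b. a \<in> U \<Longrightarrow> b \<in> V \<Longrightarrow> b \<otimes> inv a \<in> W"
proof -
  have "open {z. snd z \<otimes> inv (fst z) \<in> W}"
    using continuous_div assms(1) by (simp add: continuous_on_open_vimage vimage_def)
  moreover have "(x, y) \<in> {z. snd z \<otimes> inv (fst z) \<in> W}"
    using assms by simp
  ultimately obtain U V where "open U" "open V" "x \<in> U" "y \<in> V"
      "U \<times> V \<subseteq> {z. snd z \<otimes> inv (fst z) \<in> W}"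
    by (elim open_prod_elim) auto
  then show thesis
    by (intro that[of U V]) auto
qed

text \<open>Two distinct elements of \<open>H\<close> close enough to a common limit point would
  have a quotient different from \<open>\<one>\<close> in \<open>U \<inter> H\<close>.\<close>

lemma closed_subgroup: "closed H"
proof -
  obtain U where U: "open U" "U \<inter> H = {\<one>}"
    using discrete by blast
  have "g \<in> H" if "g islimpt H" for g
  proof -
    have "g \<otimes> inv g \<in> U"
      using U by auto
    then obtain A B where AB: "open A" "open B" "g \<in> A" "g \<in> B"
        "\<And>a b. a \<in> A \<Longrightarrow> b \<in> B \<Longrightarrow> b \<otimes> inv a \<in> U"
      using div_neighbourhoods[OF U(1), of g g] by blast
    have "open (A \<inter> B)" "g \<in> A \<inter> B"
      using AB by auto
    then obtain a where a: "a \<in> H" "a \<in> A \<inter> B" "a \<noteq> g"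
      using \<open>g islimpt H\<close> unfolding islimpt_def by blast
    have "open (A \<inter> B - {a})" "g \<in> A \<inter> B - {a}"
      using AB a by auto
    from islimptE[OF \<open>g islimpt H\<close> this(2,1)] obtain b
      where b: "b \<in> H" "b \<in> A \<inter> B - {a}" .
    have "b \<otimes> inv a \<in> U \<inter> H"
      using AB a b subgroup by (auto simp: subgroup.m_closed subgroup.m_inv_closed)
    then have "b \<otimes> inv a = \<one>"
      using U by auto
    then have "b = a"
      by (metis in_carrier inv_equality inv_inv)
    then show ?thesis
      using b by auto
  qed
  then show ?thesis
    by (simp add: closed_limpt)
qed

lemma proj_eq_imp_div: "proj a = proj b \<Longrightarrow> b \<otimes> inv a \<in> H"
  using subgroup by (auto simp: proj_eq_iff m_assoc)

text \<open>Closedness of \<open>H\<close> gives a neighbourhood of \<open>y \<otimes> inv x\<close>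
  that avoids \<open>H\<close>, whereas two points of one orbit have their quotient in
  \<open>H\<close>.\<close>

lemma Hausdorff_quot: "Hausdorff_space quot"
  unfolding Hausdorff_space_def
proof (intro allI impI)
  fix p r assume "p \<in> topspace quot \<and> r \<in> topspace quot \<and> p \<noteq> r"
  then obtain x y where xy: "p = proj x" "r = proj y" "proj x \<noteq> proj y"
    unfolding topspace_quot by auto
  have "y \<otimes> inv x \<in> - H"
  proof
    assume "y \<otimes> inv x \<in> H"
    moreover have "y = (y \<otimes> inv x) \<otimes> x"
      by (simp add: m_assoc)
    ultimately show False
      using xy(3) proj_eq_iff by blast
  qed
  then obtain U V where UV: "open U" "open V" "x \<in> U" "y \<in> V"
      "\<And>a b. a \<in> U \<Longrightarrow> b \<in> V \<Longrightarrow> b \<otimes> inv a \<in> - H"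
    using div_neighbourhoods[of "- H" y x] closed_subgroup by (metis open_Compl)
  have "disjnt (proj ` U) (proj ` V)"
    unfolding disjnt_def using UV(5) proj_eq_imp_div by fastforce
  then show "\<exists>U V. openin quot U \<and> openin quot V \<and> p \<in> U \<and> r \<in> V \<and> disjnt U V"
    using UV open_map_proj xy unfolding open_map_def by (metis imageI open_openin)
qed

lemma locally_injective: "\<exists>U. open U \<and> x \<in> U \<and> inj_on proj U"
proof -
  obtain W where W: "open W" "W \<inter> H = {\<one>}"
    using discrete by blast
  then have "x \<otimes> inv x \<in> W"
    by auto
  then obtain U V where UV: "open U" "open V" "x \<in> U" "x \<in> V"
      "\<And>a b. a \<in> U \<Longrightarrow> b \<in> V \<Longrightarrow> b \<otimes> inv a \<in> W"
    using div_neighbourhoods[OF W(1)] by metis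
  have "inj_on proj (U \<inter> V)"
  proof (rule inj_onI)
    fix a b assume *: "a \<in> U \<inter> V" "b \<in> U \<inter> V" "proj a = proj b"
    then have "b \<otimes> inv a \<in> W \<inter> H"
      using UV(5) proj_eq_imp_div by auto
    then have "b \<otimes> inv a = \<one>"
      using W by auto
    then show "a = b"
      by (metis in_carrier inv_equality inv_inv)
  qed
  then show ?thesis
    using UV by (intro exI[of _ "U \<inter> V"]) auto
qed

text \<open>Near \<open>x\<close> the chart after the projection is the left translation by an
  element of \<open>H\<close> that moves \<open>x\<close> into \<open>V\<close>.\<close>

lemma affine_cover_quot: "affine_cover quot (quotient_atlas G H) proj"
  unfolding affine_cover_def
proof (intro conjI ballI continuous_proj open_map_proj topspace_quot[symmetric])
  fix c assume "c \<in> quotient_atlas G H"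
  then obtain V where c: "c = (proj ` V, inv_into V proj)" "open V" "inj_on proj V"
    unfolding quotient_atlas_def by auto
  have "\<exists>T g. open T \<and> x \<in> T \<and> affine_map g \<and>
      (\<forall>y\<in>T. proj y \<in> proj ` V \<and> inv_into V proj (proj y) = g y)" if x: "proj x \<in> proj ` V" for x
  proof -
    obtain v where "v \<in> V" "proj x = proj v"
      using x by auto
    then obtain h where h: "h \<in> H" "h \<otimes> x \<in> V"
      using proj_eq_iff by metis
    have "proj y \<in> proj ` V \<and> inv_into V proj (proj y) = h \<otimes> y" if "h \<otimes> y \<in> V" for y
      using that c(3) proj_translate[OF h(1), of y] by (metis imageI inv_into_f_f)
    then show ?thesis
      using open_translate[OF c(2), of h] h affine_left_mult by blast
  qed
  then show "case c of (U, \<phi>) \<Rightarrow> openin quot U \<and> open (\<phi> ` U) \<and> (\<forall>a\<in>U. proj (\<phi> a) = a) \<and>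
        (\<forall>x. proj x \<in> U \<longrightarrow> (\<exists>T g. open T \<and> x \<in> T \<and> affine_map g \<and>
           (\<forall>y\<in>T. proj y \<in> U \<and> \<phi> (proj y) = g y)))"
    using c open_map_proj by (auto simp: open_map_def f_inv_into_f)
qed

lemma smooth_manifold_quot: "smooth_manifold quot (quotient_atlas G H)"
proof (rule affine_cover_smooth_manifold[OF affine_cover_quot Hausdorff_quot])
  show "(\<Union>(U, \<phi>)\<in>quotient_atlas G H. U) = topspace quot"
  proof
    show "topspace quot \<subseteq> (\<Union>(U, \<phi>)\<in>quotient_atlas G H. U)"
    proof
      fix p assume "p \<in> topspace quot"
      then obtain x where "p = proj x"
        by (auto simp: topspace_quot)
      moreover obtain U where "open U" "x \<in> U" "inj_on proj U"
        using locally_injective by blast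
      ultimately show "p \<in> (\<Union>(U, \<phi>)\<in>quotient_atlas G H. U)"
        unfolding quotient_atlas_def carrier_UNIV
        by (intro UN_I[of "(proj ` U, inv_into U proj)"]) auto
    qed
  qed (auto simp: quotient_atlas_def topspace_quot)
qed

end

section \<open>Logarithm increments and segments\<close>

definition edge_point :: "real \<Rightarrow> nat \<Rightarrow> real" where
  "edge_point s = (\<lambda>i. if i = 0 then 1 - s else if i = 1 then s else 0)"

text \<open>The coordinates \<open>a\<close> and \<open>b\<close> are the weights of the vertices 1
  and 2; the 2-simplex becomes a convex planar set, where logarithms exist.\<close>

definition triangle_point :: "real \<times> real \<Rightarrow> nat \<Rightarrow> real" where
  "triangle_point = (\<lambda>(a, b) i. if i = 0 then 1 - a - b else if i = 1 then a else if i = 2 then b else 0)"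

lemma edge_point_in: "s \<in> {0..1} \<Longrightarrow> edge_point s \<in> standard_simplex 1"
  by (auto simp: standard_simplex_def edge_point_def)

lemma triangle_point_in:
  "a \<ge> 0 \<Longrightarrow> b \<ge> 0 \<Longrightarrow> a + b \<le> 1 \<Longrightarrow> triangle_point (a, b) \<in> standard_simplex 2"
  by (auto simp: standard_simplex_def triangle_point_def numeral_2_eq_2)

lemma continuous_map_triangle_point:
  "continuous_map (top_of_set {(a, b). a \<ge> 0 \<and> b \<ge> 0 \<and> a + b \<le> 1})
     (subtopology (powertop_real UNIV) (standard_simplex 2)) triangle_point"
proof -
  have "continuous_on S (\<lambda>p. triangle_point p i)" for S i
    unfolding triangle_point_def split_def
    by (cases "i = 0"; cases "i = 1"; cases "i = 2") (auto intro!: continuous_intros)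
  then show ?thesis
    unfolding continuous_map_in_subtopology continuous_map_componentwise_UNIV
    using triangle_point_in by auto
qed

text \<open>Face \<open>i\<close> omits vertex \<open>i\<close> and keeps the order of the others,
  so the three edges run from 1 to 2, from 0 to 2 and from 0 to 1.\<close>

lemma singular_face_edge_point:
  assumes "s \<in> {0..1}"
  shows "singular_face 2 0 f (edge_point s) = f (triangle_point (1 - s, s))"
    and "singular_face 2 1 f (edge_point s) = f (triangle_point (0, s))"
    and "singular_face 2 2 f (edge_point s) = f (triangle_point (s, 0))"
proof -
  have "simplical_face 0 (edge_point s) = triangle_point (1 - s, s)"
    "simplical_face 1 (edge_point s) = triangle_point (0, s)"
    "simplical_face 2 (edge_point s) = triangle_point (s, 0)"
    by (auto simp: fun_eq_iff simplical_face_def edge_point_def triangle_point_def)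
  then show "singular_face 2 0 f (edge_point s) = f (triangle_point (1 - s, s))"
    and "singular_face 2 1 f (edge_point s) = f (triangle_point (0, s))"
    and "singular_face 2 2 f (edge_point s) = f (triangle_point (s, 0))"
    using edge_point_in[OF assms] by (simp_all add: singular_face_def)
qed

text \<open>The difference of two logarithms takes values in the multiples of 2 pi i; being
  continuous on an interval, it is constant.\<close>

lemma exp_eq_on_interval_imp_diff_eq:
  fixes l l' :: "real \<Rightarrow> complex"
  assumes "continuous_on {0..1} l" "continuous_on {0..1} l'"
    and eq: "\<And>s. s \<in> {0..1} \<Longrightarrow> exp (l s) = exp (l' s)"
  shows "l 1 - l 0 = l' 1 - l' 0"
proof -
  let ?d = "\<lambda>s. l s - l' s"
  have "?d constant_on {0..1}"
  proof (rule continuous_discrete_range_constant)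
    show "continuous_on {0..1} ?d"
      using assms by (intro continuous_intros)
    fix x :: real assume x: "x \<in> {0..1}"
    have *: "exp (?d s) = 1" if "s \<in> {0..1}" for s
      using eq[OF that] by (simp add: exp_diff)
    \<comment> \<open>Distinct values are at least 2 pi apart; the round bound 1 suffices for
      discreteness.\<close>
    have "1 \<le> norm (?d y - ?d x)" if y: "y \<in> {0..1}" "?d y \<noteq> ?d x" for y
    proof -
      have "exp (?d y - ?d x) = 1"
        using *[OF x] *[OF y(1)] by (simp only: exp_diff) simp
      then obtain n :: int where n: "Re (?d y - ?d x) = 0" "Im (?d y - ?d x) = of_int (2 * n) * pi"
        unfolding exp_eq_1 by auto
      then have "n \<noteq> 0"
        using y(2) by (auto simp: complex_eq_iff)
      then have "1 \<le> \<bar>of_int n :: real\<bar>"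
        by linarith
      then have "1 \<le> \<bar>Im (?d y - ?d x)\<bar>"
        using n pi_gt3 by (simp add: abs_mult) (smt (verit) mult_le_cancel_left1 pi_gt3)
      then show ?thesis
        using abs_Im_le_cmod order_trans by blast
    qed
    then show "\<exists>e>0. \<forall>y. y \<in> {0..1} \<and> ?d y \<noteq> ?d x \<longrightarrow> e \<le> norm (?d y - ?d x)"
      by (intro exI[of _ 1]) auto
  qed auto
  then have "?d 0 = ?d 1"
    unfolding constant_on_def by (metis atLeastAtMost_iff order_refl zero_le_one)
  then show ?thesis
    by (simp add: algebra_simps)
qed

text \<open>For a nowhere vanishing loop this is 2 pi i times the winding number around 0. The
  choice operator makes it total, so that it extends linearly to formal sums of arbitrary functions;
  without a continuous logarithm the value is arbitrary.\<close>

definition log_increment :: "(real \<Rightarrow> complex) \<Rightarrow> complex" where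
  "log_increment g = (SOME d. \<exists>l. continuous_on {0..1} l \<and>
     (\<forall>s\<in>{0..1}. g s = exp (l s)) \<and> d = l 1 - l 0)"

lemma log_increment_eq:
  assumes "continuous_on {0..1} l" "\<And>s. s \<in> {0..1} \<Longrightarrow> g s = exp (l s)"
  shows "log_increment g = l 1 - l 0"
  unfolding log_increment_def
proof (rule someI2[of _ "l 1 - l 0"])
  fix d assume "\<exists>l. continuous_on {0..1} l \<and> (\<forall>s\<in>{0..1}. g s = exp (l s)) \<and> d = l 1 - l 0"
  then obtain l' where l': "continuous_on {0..1} l'" "\<forall>s\<in>{0..1}. g s = exp (l' s)" "d = l' 1 - l' 0"
    by blast
  show "d = l 1 - l 0"
    unfolding l'(3) by (rule exp_eq_on_interval_imp_diff_eq) (use assms l' in auto)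
qed (use assms in blast)

text \<open>One logarithm \<open>L\<close> on the whole triangle computes all three increments as
  differences of vertex values, and these cancel.\<close>

lemma log_increment_triangle_boundary:
  fixes F :: "'a \<Rightarrow> complex"
  assumes F: "continuous_map X (top_of_set (- {0})) F" and f: "singular_simplex 2 X f"
  shows "log_increment (\<lambda>s. F (singular_face 2 0 f (edge_point s)))
    - log_increment (\<lambda>s. F (singular_face 2 1 f (edge_point s)))
    + log_increment (\<lambda>s. F (singular_face 2 2 f (edge_point s))) = 0"
proof -
  let ?T = "{(a, b). a \<ge> 0 \<and> b \<ge> 0 \<and> a + b \<le> 1} :: (real \<times> real) set"
  let ?g = "\<lambda>p. F (f (triangle_point p))"
  have "continuous_map (top_of_set ?T) (top_of_set (- {0})) (F \<circ> (f \<circ> triangle_point))"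
    using F f by (intro continuous_map_compose[OF _ F]
        continuous_map_compose[OF continuous_map_triangle_point]) (simp add: singular_simplex_def)
  then have g: "continuous_on ?T ?g" "\<And>p. p \<in> ?T \<Longrightarrow> ?g p \<noteq> 0"
    by (force simp: o_def continuous_map_in_subtopology)+
  have "convex ?T"
  proof (rule convexI)
    fix x y :: "real \<times> real" and u v :: real
    assume "x \<in> ?T" "y \<in> ?T" and uv: "0 \<le> u" "0 \<le> v" "u + v = 1"
    then have *: "0 \<le> fst x" "0 \<le> snd x" "fst x + snd x \<le> 1" "0 \<le> fst y" "0 \<le> snd y" "fst y + snd y \<le> 1"
      by (auto simp: split_def)
    have "u * (fst x + snd x) + v * (fst y + snd y) \<le> u * 1 + v * 1"
      using * uv by (intro add_mono mult_left_mono) auto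
    with * uv show "u *\<^sub>R x + v *\<^sub>R y \<in> ?T"
      by (simp add: split_def algebra_simps)
  qed
  then obtain L where L: "continuous_on ?T L" "\<And>p. p \<in> ?T \<Longrightarrow> ?g p = exp (L p)"
    using continuous_logarithm_on_contractible[OF g(1) convex_imp_contractible g(2)] by blast
  have "log_increment (\<lambda>s. F (singular_face 2 0 f (edge_point s))) = L (1 - 1, 1) - L (1 - 0, 0)"
    by (rule log_increment_eq[where l = "\<lambda>s. L (1 - s, s)"])
      (auto intro!: continuous_on_compose2[OF L(1)] continuous_intros simp: singular_face_edge_point L(2) simp del: One_nat_def)
  moreover have "log_increment (\<lambda>s. F (singular_face 2 1 f (edge_point s))) = L (0, 1) - L (0, 0)"
    by (rule log_increment_eq[where l = "\<lambda>s. L (0, s)"])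
      (auto intro!: continuous_on_compose2[OF L(1)] continuous_intros simp: singular_face_edge_point L(2) simp del: One_nat_def)
  moreover have "log_increment (\<lambda>s. F (singular_face 2 2 f (edge_point s))) = L (1, 0) - L (0, 0)"
    by (rule log_increment_eq[where l = "\<lambda>s. L (s, 0)"])
      (auto intro!: continuous_on_compose2[OF L(1)] continuous_intros simp: singular_face_edge_point L(2) simp del: One_nat_def)
  ultimately show ?thesis
    by simp
qed

lemma comm_group_complex_add_group: "comm_group complex_add_group"
proof (rule comm_groupI)
  fix x assume "x \<in> carrier complex_add_group"
  show "\<exists>y\<in>carrier complex_add_group. y \<otimes>\<^bsub>complex_add_group\<^esub> x = \<one>\<^bsub>complex_add_group\<^esub>"
    by (auto simp: complex_add_group_def intro: exI[of _ "- x"])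
qed (auto simp: complex_add_group_def)

text \<open>Additivity comes from the universal property of the free abelian group on all functions;
  the space \<open>X\<close> enters only for the vanishing on boundaries, which is checked on single
  2-simplices.\<close>

lemma log_increment_cocycle:
  fixes F :: "'a \<Rightarrow> complex"
  assumes F: "continuous_map X (top_of_set (- {0})) F"
  obtains h :: "'a chain \<Rightarrow> complex" where
    "\<And>a b. h (a + b) = h a + h b"
    "\<And>f. h (frag_of f) = log_increment (\<lambda>s. F (f (edge_point s)))"
    "\<And>c. singular_relboundary 1 X {} c \<Longrightarrow> h c = 0"
proof -
  obtain h where hom: "h \<in> hom (free_Abelian_group UNIV) complex_add_group"
    and h_of: "\<And>f. h (frag_of f) = log_increment (\<lambda>s. F (f (edge_point s)))"
    using comm_group.free_Abelian_group_universal[OF comm_group_complex_add_group,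
        of "\<lambda>f. log_increment (\<lambda>s. F (f (edge_point s)))" UNIV]
    by (auto simp: complex_add_group_def)
  have add: "h (a + b) = h a + h b" for a b
    using hom_mult[OF hom, of a b] by (simp add: complex_add_group_def)
  have zero: "h 0 = 0"
    using add[of 0 0] by simp
  have minus: "h (a - b) = h a - h b" for a b
    using add[of "a - b" b] by (simp add: algebra_simps)
  have "h (chain_boundary 2 d) = 0" if "singular_chain 2 X d" for d
    using that unfolding singular_chain_def
  proof (induction d rule: frag_induction)
    case (one f)
    have "chain_boundary 2 (frag_of f) =
        frag_of (singular_face 2 0 f) - frag_of (singular_face 2 1 f) + frag_of (singular_face 2 2 f)"
      by (simp add: chain_boundary_of numeral_2_eq_2)
    then show ?case
      using log_increment_triangle_boundary[OF F] one by (simp add: add minus h_of)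
  qed (auto simp: chain_boundary_diff minus zero)
  then have "h c = 0" if "singular_relboundary 1 X {} c" for c
    using that unfolding singular_boundary by (auto simp: numeral_2_eq_2)
  with add h_of show thesis
    by (rule that)
qed


text \<open>The straight-line homotopy contracts the space to 0, so the cycle is homologous to its
  image in a one-point space, where every cycle of positive degree bounds.\<close>

lemma euclidean_cycle_imp_boundary:
  assumes c: "singular_relcycle p (euclidean :: 'e::real_normed_vector topology) {} c" and "p \<noteq> 0"
  shows "singular_relboundary p euclidean {} c"
proof -
  let ?a = "0 :: 'e" and ?E = "euclidean :: 'e topology"
  have "homotopic_with (\<lambda>h. h \<in> {} \<rightarrow> {}) ?E ?E id (\<lambda>x. ?a)"
  proof -
    have "continuous_on ({0..1} \<times> UNIV) (\<lambda>z. (1 - fst z) *\<^sub>R (snd z :: 'e))"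
      by (intro continuous_intros)
    then have "continuous_map (prod_topology (top_of_set {0..1}) ?E) ?E (\<lambda>z. (1 - fst z) *\<^sub>R snd z)"
      using prod_topology_subtopology_eu[of "{0..1::real}" "UNIV :: 'e set"] by simp
    then show ?thesis
      unfolding homotopic_with_def
      by (intro exI[of _ "\<lambda>z. (1 - fst z) *\<^sub>R snd z"]) auto
  qed
  from homotopic_imp_homologous_rel_chain_maps[OF this c]
  have "homologous_rel p ?E {} (chain_map p id c) (chain_map p (\<lambda>x. ?a) c)" .
  moreover have "chain_map p id c = c"
    using c by (intro chain_map_id_gen) (auto simp: singular_cycle singular_chain_def)
  moreover have "singular_relboundary p ?E {} (chain_map p (\<lambda>x. ?a) c)"
  proof -
    have "singular_relcycle p (subtopology ?E {?a}) {} (chain_map p (\<lambda>x. ?a) c)"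
      using c by (rule singular_relcycle_chain_map) auto
    then have "singular_relboundary p (subtopology ?E {?a}) {} (chain_map p (\<lambda>x. ?a) c)"
      using singular_boundary_eq_cycle_singleton[of "subtopology ?E {?a}" ?a p] \<open>p \<noteq> 0\<close> by simp
    then show ?thesis
      using singular_boundary_mono[of "{?a}" UNIV p ?E] by simp
  qed
  ultimately show ?thesis
    by (metis homologous_rel_eq homologous_rel_eq_relboundary homologous_rel_sym)
qed

section \<open>Points and straight segments as singular simplices\<close>

definition point_simplex :: "'a \<Rightarrow> (nat \<Rightarrow> real) \<Rightarrow> 'a" where
  "point_simplex a = restrict (\<lambda>_. a) (standard_simplex 0)"

definition segment_simplex :: "'a::real_vector \<Rightarrow> 'a \<Rightarrow> (nat \<Rightarrow> real) \<Rightarrow> 'a" where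
  "segment_simplex x y = restrict (\<lambda>t. t 0 *\<^sub>R x + t 1 *\<^sub>R y) (standard_simplex 1)"

lemma singular_simplex_segment_simplex:
  fixes x y :: "'e::real_normed_vector"
  shows "singular_simplex 1 euclidean (segment_simplex x y)"
proof -
  have "continuous_map (powertop_real UNIV) euclidean (\<lambda>t. t 0 *\<^sub>R x + t 1 *\<^sub>R y)"
    unfolding euclidean_product_topology by (auto intro!: continuous_intros)
  from continuous_map_from_subtopology[OF this, of "standard_simplex 1"] show ?thesis
    unfolding singular_simplex_def segment_simplex_def
    by (auto elim!: continuous_map_eq)
qed

lemma segment_simplex_edge_point:
  "s \<in> {0..1} \<Longrightarrow> segment_simplex x y (edge_point s) = (1 - s) *\<^sub>R x + s *\<^sub>R y"
  using edge_point_in[of s] by (simp add: segment_simplex_def) (simp add: edge_point_def)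

lemma chain_boundary_1_of:
  "chain_boundary 1 (frag_of f) =
     frag_of (point_simplex (f (edge_point 1))) - frag_of (point_simplex (f (edge_point 0)))"
proof -
  have *: "simplical_face 0 (\<lambda>j. if j = 0 then 1 else 0) = edge_point 1"
    "simplical_face 1 (\<lambda>j. if j = 0 then 1 else 0) = edge_point 0"
    by (auto simp: fun_eq_iff simplical_face_def edge_point_def)
  have "singular_face 1 0 f = point_simplex (f (edge_point 1))"
    "singular_face 1 1 f = point_simplex (f (edge_point 0))"
    unfolding singular_face_def point_simplex_def
    by (auto simp: * standard_simplex_0 simp del: One_nat_def intro!: restrict_ext)
  then show ?thesis
    by (simp add: chain_boundary_of)
qed

lemma chain_boundary_1_segment:
  "chain_boundary 1 (frag_of (segment_simplex x y)) =
     frag_of (point_simplex y) - frag_of (point_simplex x)"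
  unfolding chain_boundary_1_of by (simp add: segment_simplex_edge_point)

section \<open>Loops generate the first homology group\<close>

context discrete_affine_subgroup
begin

text \<open>The endpoints are points upstairs, because their orbits do not determine the projected
  segment even up to homology.\<close>

definition path_chain :: "'e \<Rightarrow> 'e \<Rightarrow> 'e set chain" where
  "path_chain x y = chain_map 1 proj (frag_of (segment_simplex x y))"

abbreviation "homologous \<equiv> homologous_rel 1 quot {}"

lemma path_chain_eq: "path_chain x y = frag_of (simplex_map 1 proj (segment_simplex x y))"
  by (simp add: path_chain_def)

lemma singular_chain_path_chain: "singular_chain 1 quot (path_chain x y)"
  unfolding path_chain_def
  by (rule singular_chain_chain_map[OF _ continuous_proj])
    (simp add: singular_chain_of singular_simplex_segment_simplex del: One_nat_def)

lemma simplex_map_segment_edge_point: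
  assumes "s \<in> {0..1}"
  shows "simplex_map 1 proj (segment_simplex x y) (edge_point s) = proj ((1 - s) *\<^sub>R x + s *\<^sub>R y)"
  using edge_point_in[OF assms]
  by (simp add: simplex_map_def segment_simplex_edge_point[OF assms])

lemma chain_boundary_path_chain:
  "chain_boundary 1 (path_chain x y) = frag_of (point_simplex (proj y)) - frag_of (point_simplex (proj x))"
  unfolding path_chain_eq chain_boundary_1_of
  by (simp add: simplex_map_segment_edge_point del: One_nat_def)

text \<open>The source of the relations between path chains: a cycle upstairs bounds because
  Euclidean space is contractible, and boundaries project to boundaries.\<close>

lemma projected_cycle_boundary:
  assumes "singular_chain 1 euclidean c" "chain_boundary 1 c = 0"
  shows "singular_relboundary 1 quot {} (chain_map 1 proj c)"
proof -
  have "singular_relboundary 1 euclidean {} c"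
    using assms by (intro euclidean_cycle_imp_boundary) (auto simp: singular_cycle)
  then show ?thesis
    using singular_relboundary_chain_map[OF _ continuous_proj] by blast
qed

lemma path_chain_trans: "homologous (path_chain x y + path_chain y z) (path_chain x z)"
proof -
  let ?s = "\<lambda>a b. frag_of (segment_simplex a b)"
  have "singular_relboundary 1 quot {} (chain_map 1 proj (?s x y + ?s y z - ?s x z))"
    by (rule projected_cycle_boundary)
      (simp_all add: chain_boundary_diff chain_boundary_add chain_boundary_1_segment singular_chain_of
        singular_chain_diff singular_chain_add singular_simplex_segment_simplex del: One_nat_def)
  then show ?thesis
    by (simp add: homologous_rel_def chain_map_diff chain_map_add path_chain_def del: chain_map_of)
qed

lemma path_chain_refl: "homologous (path_chain x x) 0"
  using homologous_rel_diff[OF path_chain_trans[of x x x] homologous_rel_refl[of _ _ _ "path_chain x x"]]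
  by simp

lemma path_chain_sym: "homologous (- path_chain x y) (path_chain y x)"
proof -
  have "homologous (path_chain x y + path_chain y x) 0"
    using path_chain_trans[of x y x] path_chain_refl homologous_rel_trans by blast
  from homologous_rel_diff[OF this homologous_rel_refl[of _ _ _ "path_chain x y"]]
  have "homologous (path_chain y x) (- path_chain x y)"
    by simp
  then show ?thesis
    by (simp add: homologous_rel_sym)
qed

text \<open>An affine map preserves barycentric combinations, so the two projected simplices
  coincide as functions, not merely up to homology.\<close>

lemma path_chain_translate:
  assumes "h \<in> H"
  shows "path_chain (h \<otimes> x) (h \<otimes> y) = path_chain x y"
proof -
  obtain L b where L: "linear L" "\<And>x. h \<otimes> x = L x + b"
    using affine_left_mult[of h] unfolding affine_map_def by metis
  have "t 0 *\<^sub>R (h \<otimes> x) + t 1 *\<^sub>R (h \<otimes> y) = h \<otimes> (t 0 *\<^sub>R x + t 1 *\<^sub>R y)"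
    if "t \<in> standard_simplex 1" for t
  proof -
    have "t 0 + t 1 = 1"
      using that by (simp add: standard_simplex_def)
    then have "t 0 *\<^sub>R b + t 1 *\<^sub>R b = b"
      by (metis scaleR_left_distrib scaleR_one)
    then show ?thesis
      by (simp add: L linear_add linear_scale scaleR_add_right algebra_simps)
  qed
  then have "simplex_map 1 proj (segment_simplex (h \<otimes> x) (h \<otimes> y)) = simplex_map 1 proj (segment_simplex x y)"
    unfolding simplex_map_def segment_simplex_def
    by (intro restrict_ext) (simp add: proj_translate[OF assms] del: One_nat_def)
  then show ?thesis
    by (simp add: path_chain_eq)
qed

definition loop_chain :: "'e \<Rightarrow> 'e set chain" where
  "loop_chain g = path_chain \<one> g"

text \<open>The broken path from \<open>\<one>\<close> over \<open>g\<close> to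
  \<open>g \<otimes> h\<close> has as second leg the translate by \<open>g\<close> of the segment
  from \<open>\<one>\<close> to \<open>h\<close>.\<close>

lemma loop_chain_mult:
  assumes "g \<in> H"
  shows "homologous (loop_chain g + loop_chain h) (loop_chain (g \<otimes> h))"
  using path_chain_trans[of \<one> g "g \<otimes> h"] path_chain_translate[OF assms, of \<one> h]
  by (simp add: loop_chain_def)

lemma loop_chain_inv:
  assumes "g \<in> H"
  shows "homologous (- loop_chain g) (loop_chain (inv g))"
proof -
  have "path_chain g \<one> = path_chain \<one> (inv g)"
    using path_chain_translate[OF assms, of \<one> "inv g"] by simp
  then show ?thesis
    using path_chain_sym[of \<one> g] by (simp add: loop_chain_def)
qed

lemma loop_chain_cycle:
  assumes "g \<in> H"
  shows "singular_relcycle 1 quot {} (loop_chain g)"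
proof -
  have "proj g = proj \<one>"
    using proj_translate[OF assms, of \<one>] by simp
  then show ?thesis
    using singular_chain_path_chain by (simp add: singular_cycle loop_chain_def chain_boundary_path_chain del: One_nat_def)
qed

text \<open>The chain \<open>base_chain c\<close> joins the base point to chosen lifts of the points of the
  0-chain \<open>c\<close>.\<close>

definition base_chain :: "'e set chain \<Rightarrow> 'e set chain" where
  "base_chain = frag_extend (\<lambda>p. path_chain \<one> (SOME x. proj x = p (edge_point 0)))"

text \<open>Lift \<open>f\<close> through \<open>V\<close> and straighten it to a segment from
  \<open>x = g \<otimes> a\<close> to \<open>y = h \<otimes> b\<close>, where \<open>a\<close> and
  \<open>b\<close> are the chosen lifts of the endpoints. On the detour over \<open>g\<close> and
  \<open>h\<close>, the outer legs are translates of segments between \<open>\<one>\<close> and the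
  chosen lifts, and the middle leg is a translate of the segment from \<open>\<one>\<close> to
  \<open>inv g \<otimes> h\<close>.\<close>

lemma homologous_loop_plus_base:
  assumes f: "singular_simplex 1 quot f" and V: "inj_on proj V" "open V"
    and fV: "f ` standard_simplex 1 \<subseteq> proj ` V"
  shows "\<exists>g\<in>H. homologous (frag_of f) (loop_chain g + base_chain (chain_boundary 1 (frag_of f)))"
proof -
  define k where "k = restrict (inv_into V proj \<circ> f) (standard_simplex 1)"
  have ov: "openin quot (proj ` V)"
    using open_map_proj V by (auto simp: open_map_def)
  have "(proj ` V, inv_into V proj) \<in> quotient_atlas G H"
    using V by (auto simp: quotient_atlas_def carrier_UNIV)
  from affine_cover_chart_on[OF affine_cover_quot this]
  have "continuous_map (subtopology quot (proj ` V)) euclidean (inv_into V proj)"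
    unfolding chart_on_def split_conv
    by (auto dest!: homeomorphic_imp_continuous_map simp: continuous_map_in_subtopology)
  moreover have "continuous_map (subtopology (powertop_real UNIV) (standard_simplex 1)) (subtopology quot (proj ` V)) f"
    using f fV by (simp add: singular_simplex_def continuous_map_in_subtopology image_subset_iff_funcset)
  ultimately have kc: "continuous_map (subtopology (powertop_real UNIV) (standard_simplex 1)) euclidean
      (inv_into V proj \<circ> f)"
    by (rule continuous_map_compose[rotated])
  have "continuous_map (subtopology (powertop_real UNIV) (standard_simplex 1)) euclidean k"
    by (rule continuous_map_eq[OF kc]) (simp add: k_def)
  then have k: "singular_simplex 1 euclidean k"
    by (simp add: k_def singular_simplex_def del: One_nat_def)
  have pk: "proj (k t) = f t" if "t \<in> standard_simplex 1" for t
    using that fV by (auto simp: k_def f_inv_into_f simp del: One_nat_def)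
  have f_eq: "simplex_map 1 proj k = f"
    using f pk unfolding simplex_map_def singular_simplex_def
    by (intro extensionalityI[of _ "standard_simplex 1"]) auto
  have e01: "edge_point 0 \<in> standard_simplex 1" "edge_point 1 \<in> standard_simplex 1"
    using edge_point_in by auto
  define x where "x = k (edge_point 0)"
  define y where "y = k (edge_point 1)"
  define a where "a = (SOME z. proj z = f (edge_point 0))"
  define b where "b = (SOME z. proj z = f (edge_point 1))"
  have "proj a = proj x" "proj b = proj y"
    unfolding a_def b_def x_def y_def using pk e01 by (metis (mono_tags, lifting) someI)+
  then obtain g h where gh: "g \<in> H" "h \<in> H" "x = g \<otimes> a" "y = h \<otimes> b"
    unfolding proj_eq_iff by auto
  have 1: "homologous (frag_of f) (path_chain x y)"
  proof -
    have "singular_relboundary 1 quot {} (chain_map 1 proj (frag_of k - frag_of (segment_simplex x y)))"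
      using k by (intro projected_cycle_boundary)
        (simp_all add: chain_boundary_diff chain_boundary_1_segment chain_boundary_1_of x_def y_def
          singular_chain_of singular_chain_diff singular_simplex_segment_simplex
          segment_simplex_edge_point del: One_nat_def)
    then show ?thesis
      using f_eq by (simp add: homologous_rel_def chain_map_diff path_chain_def)
  qed
  have 2: "path_chain x g = path_chain a \<one>" "path_chain h y = path_chain \<one> b"
    using path_chain_translate[OF gh(1), of a \<one>] path_chain_translate[OF gh(2), of \<one> b] gh by simp_all
  have 3: "path_chain g h = loop_chain (inv g \<otimes> h)"
    using path_chain_translate[OF gh(1), of \<one> "inv g \<otimes> h"] by (simp add: loop_chain_def m_assoc[symmetric])
  have "homologous (path_chain x g + path_chain g h + path_chain h y) (path_chain x y)"
    using path_chain_trans homologous_rel_add homologous_rel_refl homologous_rel_trans by meson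
  then have 4: "homologous (frag_of f) (path_chain a \<one> + loop_chain (inv g \<otimes> h) + path_chain \<one> b)"
    using 1 unfolding 2 3 by (meson homologous_rel_sym homologous_rel_trans)
  have 5: "homologous (path_chain a \<one> + loop_chain (inv g \<otimes> h) + path_chain \<one> b)
      (- path_chain \<one> a + loop_chain (inv g \<otimes> h) + path_chain \<one> b)"
    by (intro homologous_rel_add homologous_rel_refl) (rule path_chain_sym[THEN homologous_rel_sym[THEN iffD1]])
  have "base_chain (chain_boundary 1 (frag_of f)) = path_chain \<one> b - path_chain \<one> a"
  proof -
    \<comment> \<open>\<open>edge_point 0\<close> is the vertex (1, 0, 0, ...), which is also the
      only point of the standard 0-simplex, where \<open>base_chain\<close> reads off the
      value.\<close>
    have "edge_point 0 \<in> standard_simplex 0"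
      by (auto simp: standard_simplex_0 edge_point_def)
    then show ?thesis
      unfolding chain_boundary_1_of base_chain_def frag_extend_diff a_def b_def
      by (simp add: point_simplex_def)
  qed
  then have "- path_chain \<one> a + loop_chain (inv g \<otimes> h) + path_chain \<one> b =
      loop_chain (inv g \<otimes> h) + base_chain (chain_boundary 1 (frag_of f))"
    by simp
  with homologous_rel_trans[OF 5 4]
  have "homologous (frag_of f) (loop_chain (inv g \<otimes> h) + base_chain (chain_boundary 1 (frag_of f)))"
    by metis
  moreover have "inv g \<otimes> h \<in> H"
    using gh subgroup by (simp add: subgroup.m_closed subgroup.m_inv_closed)
  ultimately show ?thesis
    by blast
qed

text \<open>The claim with the term \<open>base_chain (chain_boundary 1 c')\<close> makes sense for
  chains that are not cycles and is compatible with differences, so it can be proved simplex by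
  simplex; for a cycle the term is 0.\<close>

lemma cycle_homologous_loop:
  assumes c: "singular_relcycle 1 quot {} c"
  shows "\<exists>g\<in>H. homologous c (loop_chain g)"
proof -
  define \<C> where "\<C> = {proj ` V |V. open V \<and> inj_on proj V}"
  have "\<And>U. U \<in> \<C> \<Longrightarrow> openin quot U"
    using open_map_proj by (auto simp: open_map_def \<C>_def)
  moreover have "topspace quot \<subseteq> \<Union>\<C>"
    using locally_injective unfolding topspace_quot \<C>_def by blast
  ultimately obtain c' where c': "singular_relcycle 1 quot {} c'" "homologous c c'"
      "\<And>f. f \<in> Poly_Mapping.keys c' \<Longrightarrow> \<exists>V \<in> \<C>. f \<in> (standard_simplex 1) \<rightarrow> V"
    using small_homologous_rel_relcycle_exists[OF _ _ c] by metis
  have "Poly_Mapping.keys c' \<subseteq> {f. singular_simplex 1 quot f \<and> (\<exists>V\<in>\<C>. f \<in> standard_simplex 1 \<rightarrow> V)}"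
    using c' by (auto simp: singular_cycle singular_chain_def)
  then have "\<exists>g\<in>H. homologous c' (loop_chain g + base_chain (chain_boundary 1 c'))"
  proof (induction c' rule: frag_induction)
    case zero
    have "\<one> \<in> H"
      using subgroup by (simp add: subgroup.one_closed)
    then show ?case
      using path_chain_refl[of \<one>] by (auto simp: base_chain_def loop_chain_def homologous_rel_sym)
  next
    case (one f)
    then obtain V where "singular_simplex 1 quot f" "open V" "inj_on proj V" "f ` standard_simplex 1 \<subseteq> proj ` V"
      unfolding \<C>_def by (auto simp del: One_nat_def)
    then show ?case
      using homologous_loop_plus_base by blast
  next
    case (diff a b)
    then obtain g h where gh: "g \<in> H" "h \<in> H"
      "homologous a (loop_chain g + base_chain (chain_boundary 1 a))"
      "homologous b (loop_chain h + base_chain (chain_boundary 1 b))"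
      by blast
    have *: "base_chain (chain_boundary 1 (a - b)) = base_chain (chain_boundary 1 a) - base_chain (chain_boundary 1 b)"
      by (simp add: base_chain_def chain_boundary_diff frag_extend_diff)
    have "homologous (loop_chain g + - loop_chain h) (loop_chain (g \<otimes> inv h))"
      using loop_chain_mult[OF gh(1), of "inv h"] loop_chain_inv[OF gh(2)]
        homologous_rel_add homologous_rel_refl homologous_rel_trans by meson
    then have "homologous (loop_chain g - loop_chain h + base_chain (chain_boundary 1 (a - b)))
        (loop_chain (g \<otimes> inv h) + base_chain (chain_boundary 1 (a - b)))"
      by (simp add: homologous_rel_add)
    moreover have "homologous (a - b) (loop_chain g - loop_chain h + base_chain (chain_boundary 1 (a - b)))"
      using homologous_rel_diff[OF gh(3,4)] by (simp add: * algebra_simps del: One_nat_def)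
    ultimately have "homologous (a - b) (loop_chain (g \<otimes> inv h) + base_chain (chain_boundary 1 (a - b)))"
      using homologous_rel_trans by blast
    moreover have "g \<otimes> inv h \<in> H"
      using gh subgroup by (simp add: subgroup.m_closed subgroup.m_inv_closed)
    ultimately show ?case
      by blast
  qed
  then show ?thesis
    using c'(1) homologous_rel_trans[OF _ c'(2)] by (auto simp: singular_cycle base_chain_def)
qed

section \<open>Homology classes of group elements\<close>

definition loop_class :: "'e \<Rightarrow> 'e set chain set" where
  "loop_class g = homologous_rel_set 1 quot {} (loop_chain g)"

end

lemma homologous_rel_set_add:
  assumes "singular_relcycle p X S a" "singular_relcycle p X S b"
  shows "homologous_rel_set p X S a \<otimes>\<^bsub>relative_homology_group (int p) X S\<^esub> homologous_rel_set p X S b =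
    homologous_rel_set p X S (a + b)"
proof -
  have "r_coset (relcycle_group p X S) (singular_relboundary_set p X S) (a \<otimes>\<^bsub>relcycle_group p X S\<^esub> b) =
      r_coset (relcycle_group p X S) (singular_relboundary_set p X S) a <#>\<^bsub>relcycle_group p X S\<^esub>
      r_coset (relcycle_group p X S) (singular_relboundary_set p X S) b"
    using normal.rcos_sum[OF normal_subgroup_singular_relboundary_relcycle, of a p X S b] assms by simp
  then show ?thesis
    unfolding right_coset_singular_relboundary
    by (simp add: relative_homology_group_def FactGroup_def)
qed

context discrete_affine_subgroup
begin

abbreviation "H1 \<equiv> homology_group 1 quot"

lemma loop_class_hom: "loop_class \<in> hom (G\<lparr>carrier := H\<rparr>) H1"
proof (rule homI)
  fix g assume "g \<in> carrier (G\<lparr>carrier := H\<rparr>)"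
  then show "loop_class g \<in> carrier H1"
    using carrier_relative_homology_group[of 1 quot "{}"] loop_chain_cycle by (auto simp: loop_class_def)
next
  fix g h assume "g \<in> carrier (G\<lparr>carrier := H\<rparr>)" "h \<in> carrier (G\<lparr>carrier := H\<rparr>)"
  then have "g \<in> H" "h \<in> H" by auto
  then show "loop_class (g \<otimes>\<^bsub>G\<lparr>carrier := H\<rparr>\<^esub> h) = loop_class g \<otimes>\<^bsub>H1\<^esub> loop_class h"
    using homologous_rel_set_add[of 1 quot "{}" "loop_chain g" "loop_chain h"] loop_chain_cycle loop_chain_mult[of g h]
    by (simp add: loop_class_def homologous_rel_set_eq homologous_rel_sym)
qed

lemma carrier_H1: "carrier H1 = loop_class ` H"
proof
  show "carrier H1 \<subseteq> loop_class ` H"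
  proof
    fix \<xi> assume "\<xi> \<in> carrier H1"
    then obtain c where "singular_relcycle 1 quot {} c" "\<xi> = homologous_rel_set 1 quot {} c"
      using carrier_relative_homology_group[of 1 quot "{}"] by auto
    then show "\<xi> \<in> loop_class ` H"
      using cycle_homologous_loop[of c] by (auto simp: loop_class_def homologous_rel_set_eq)
  qed
next
  show "loop_class ` H \<subseteq> carrier H1"
    using loop_class_hom by (auto simp: hom_def)
qed

end

section \<open>The first Betti number\<close>

text \<open>If the \<open>N\<close>-th powers of two elements are \<open>e [^] k1\<close> and
  \<open>e [^] k2\<close>, raising these to \<open>k2\<close> and \<open>- k1\<close> yields a
  relation between the elements, so no independent set has two members.\<close>

lemma abelian_rank_eq_1:
  fixes A (structure)
  assumes "comm_group A" and e: "e \<in> carrier A" "\<And>k::int. e [^] k = \<one> \<Longrightarrow> k = 0"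
    and N: "N \<noteq> (0::int)" "\<And>x. x \<in> carrier A \<Longrightarrow> \<exists>k::int. x [^] N = e [^] k"
  shows "abelian_rank A = 1"
proof -
  interpret comm_group A by fact
  have "int_independent A {e}"
    using e by (auto simp: int_independent_def)
  then have "{e} \<in> {B. finite B \<and> B \<subseteq> carrier A \<and> int_independent A B}"
    using e by auto
  then have "enat (card {e}) \<le> abelian_rank A"
    unfolding abelian_rank_def by (rule SUP_upper)
  moreover have "abelian_rank A \<le> 1"
    unfolding abelian_rank_def
  proof (rule SUP_least, clarify)
    fix B assume B: "finite B" "B \<subseteq> carrier A" "int_independent A B"
    have "b1 = b2" if b: "b1 \<in> B" "b2 \<in> B" for b1 b2
    proof (rule ccontr)
      assume "b1 \<noteq> b2"
      have bc: "b1 \<in> carrier A" "b2 \<in> carrier A"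
        using b B by auto
      define R where "R = B - {b1, b2}"
      have R: "finite R" "b1 \<notin> R" "b2 \<notin> R" "R \<subseteq> carrier A"
        using B by (auto simp: R_def)
      have B_eq: "B = insert b1 (insert b2 R)"
        using b by (auto simp: R_def)
      have indep: "b1 [^] i \<otimes> b2 [^] j = \<one> \<Longrightarrow> i = 0 \<and> j = 0" for i j :: int
      proof -
        assume ij: "b1 [^] i \<otimes> b2 [^] j = \<one>"
        define k where "k = (\<lambda>b. if b = b1 then i else if b = b2 then j else 0)"
        have "(\<Otimes>b\<in>R. b [^] k b) = \<one>"
          using R by (intro finprod_one_eqI) (auto simp: k_def)
        then have "(\<Otimes>b\<in>B. b [^] k b) = b1 [^] k b1 \<otimes> b2 [^] k b2"
          unfolding B_eq using R \<open>b1 \<noteq> b2\<close> bc by (subst finprod_insert; auto)+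
        also have "\<dots> = \<one>"
          using ij \<open>b1 \<noteq> b2\<close> by (simp add: k_def)
        finally have "\<forall>b\<in>B. k b = 0"
          using B(3) unfolding int_independent_def by blast
        then show "i = 0 \<and> j = 0"
          using b \<open>b1 \<noteq> b2\<close> by (auto simp: k_def split: if_splits)
      qed
      obtain k1 k2 :: int where k: "b1 [^] N = e [^] k1" "b2 [^] N = e [^] k2"
        using N bc by metis
      have "b1 [^] (N * k2) = e [^] (k1 * k2)"
        using k bc e by (metis int_pow_pow)
      moreover have "b2 [^] (N * - k1) = e [^] (k2 * - k1)"
        using k bc e by (metis int_pow_pow)
      ultimately have "b1 [^] (N * k2) \<otimes> b2 [^] (N * - k1) = \<one>"
        using e by (simp add: int_pow_mult[symmetric] mult.commute)
      \<comment> \<open>Independence forces \<open>k1 = 0\<close>; but then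
        \<open>b1 [^] N = \<one>\<close> is itself a nontrivial relation.\<close>
      then have "k1 = 0"
        using indep N by fastforce
      then have "b1 [^] N \<otimes> b2 [^] (0::int) = \<one>"
        using k bc by simp
      then show False
        using indep N by blast
    qed
    then have "card B \<le> 1"
      using B(1) by (simp add: card_le_Suc0_iff_eq)
    then show "enat (card B) \<le> 1"
      by (simp add: one_enat_def)
  qed
  ultimately show ?thesis
    by (simp add: one_enat_def)
qed

context discrete_affine_subgroup
begin

lemma loop_class_eq_one_iff: "loop_class g = \<one>\<^bsub>H1\<^esub> \<longleftrightarrow> singular_relboundary 1 quot {} (loop_chain g)"
  unfolding loop_class_def
  using homologous_rel_set_eq_relboundary[of 1 quot "{}"] one_relative_homology_group[of 1 quot "{}"] by simp

text \<open>The function exp (2 pi i \<open>\<tau>\<close>) is invariant under \<open>H\<close> and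
  descends to a nowhere zero function on the quotient. Along the loop of \<open>g\<close> its
  logarithm grows by 2 pi i \<open>\<tau> g\<close>, and the increment of a boundary is 0.\<close>

lemma loop_class_one_imp_character_zero:
  fixes \<tau> :: "'e \<Rightarrow> real"
  assumes \<tau>: "continuous_on UNIV \<tau>" "\<And>x y. \<tau> (x \<otimes> y) = \<tau> x + \<tau> y" "\<And>h. h \<in> H \<Longrightarrow> \<tau> h \<in> \<int>"
    and g: "loop_class g = \<one>\<^bsub>H1\<^esub>"
  shows "\<tau> g = 0"
proof -
  define E where "E x = exp (2 * pi * \<i> * of_real (\<tau> x))" for x
  have E_H: "E h = 1" if h: "h \<in> H" for h
  proof -
    obtain n where "\<tau> h = of_int n"
      using \<tau>(3)[OF h] Ints_cases by blast
    then show ?thesis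
      unfolding E_def exp_eq_1 by (auto intro!: exI[of _ n])
  qed
  have E_mult: "E (x \<otimes> y) = E x * E y" for x y
    by (simp add: E_def \<tau>(2) algebra_simps exp_add)
  define F where "F p = E (SOME x. proj x = p)" for p
  have F_proj: "F (proj x) = E x" for x
  proof -
    have "proj (SOME y. proj y = proj x) = proj x"
      by (rule someI) simp
    then obtain h where "h \<in> H" "x = h \<otimes> (SOME y. proj y = proj x)"
      unfolding proj_eq_iff by blast
    then show ?thesis
      unfolding F_def using E_mult E_H by (metis mult_1)
  qed
  have "continuous_map euclidean (top_of_set (- {0})) (F \<circ> proj)"
  proof -
    have "continuous_on UNIV E"
      unfolding E_def using \<tau>(1) by (intro continuous_intros)
    then show ?thesis
      by (auto simp: o_def F_proj continuous_map_in_subtopology E_def)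
  qed
  then have F: "continuous_map quot (top_of_set (- {0})) F"
    using continuous_compose_quotient_map[OF quotient_map_quotient_space[OF carrier_UNIV]] by blast
  obtain h :: "'e set chain \<Rightarrow> complex" where h:
    "\<And>f. h (frag_of f) = log_increment (\<lambda>s. F (f (edge_point s)))"
    "\<And>c. singular_relboundary 1 quot {} c \<Longrightarrow> h c = 0"
    using log_increment_cocycle[OF F] by metis
  define l where "l s = 2 * pi * \<i> * of_real (\<tau> ((1 - s) *\<^sub>R \<one> + s *\<^sub>R g))" for s
  have "h (loop_chain g) = l 1 - l 0"
    unfolding loop_chain_def path_chain_eq h(1)
  proof (rule log_increment_eq)
    show "continuous_on {0..1} l"
      unfolding l_def by (intro continuous_intros continuous_on_compose2[OF \<tau>(1)]) auto
    show "F (simplex_map 1 proj (segment_simplex \<one> g) (edge_point s)) = exp (l s)" if "s \<in> {0..1}" for s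
      using simplex_map_segment_edge_point[OF that] by (simp add: F_proj E_def l_def del: One_nat_def)
  qed
  moreover have "h (loop_chain g) = 0"
    using g h(2) loop_class_eq_one_iff by blast
  moreover have "\<tau> \<one> = 0"
    using \<tau>(2)[of \<one> \<one>] by simp
  ultimately show ?thesis
    by (simp add: l_def)
qed

lemma loop_class_mult:
  "g \<in> H \<Longrightarrow> h \<in> H \<Longrightarrow> loop_class (g \<otimes> h) = loop_class g \<otimes>\<^bsub>H1\<^esub> loop_class h"
  using hom_mult[OF loop_class_hom] by simp

lemma loop_class_closed: "g \<in> H \<Longrightarrow> loop_class g \<in> carrier H1"
  using carrier_H1 by auto

lemma loop_class_group_hom: "group_hom (G\<lparr>carrier := H\<rparr>) H1 loop_class"
  using loop_class_hom subgroup.subgroup_is_group[OF subgroup is_group]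
  by (intro group_hom.intro group_hom_axioms.intro) auto

lemma loop_class_int_pow:
  assumes "g \<in> H"
  shows "loop_class (g [^] (k::int)) = loop_class g [^]\<^bsub>H1\<^esub> k"
  using group_hom.hom_int_pow[OF loop_class_group_hom, of g k] assms
    int_pow_consistent[OF subgroup assms, of k] by simp

text \<open>The character shows that the class of \<open>g\<close> has infinite order, so the rank
  is at least 1; the common exponent \<open>N\<close> bounds it from above.\<close>

lemma betti_number_1_eq_1:
  fixes \<tau> :: "'e \<Rightarrow> real"
  assumes \<tau>: "continuous_on UNIV \<tau>" "\<And>x y. \<tau> (x \<otimes> y) = \<tau> x + \<tau> y" "\<And>h. h \<in> H \<Longrightarrow> \<tau> h \<in> \<int>"
    and g: "g \<in> H" "\<tau> g \<noteq> 0"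
    and N: "N \<noteq> (0::int)" "\<And>h. h \<in> H \<Longrightarrow> \<exists>k::int. loop_class h [^]\<^bsub>H1\<^esub> N = loop_class g [^]\<^bsub>H1\<^esub> k"
  shows "betti_number 1 quot = 1"
proof -
  have pow: "\<tau> (g [^] n) = of_nat n * \<tau> g" for n :: nat
  proof (induction n)
    case 0
    then show ?case using \<tau>(2)[of \<one> \<one>] by simp
  qed (simp add: \<tau>(2) algebra_simps)
  have ipow: "\<tau> (g [^] k) = of_int k * \<tau> g" for k :: int
  proof (cases k rule: int_cases2)
    case (nonneg n)
    then show ?thesis using pow[of n] by (simp add: int_pow_int)
  next
    case (nonpos n)
    have "\<tau> (g [^] n) + \<tau> (inv (g [^] n)) = 0"
      using \<tau>(2)[of "g [^] n" "inv (g [^] n)"] \<tau>(2)[of \<one> \<one>] by simp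
    then show ?thesis
      using nonpos pow[of n] by (simp add: int_pow_neg_int)
  qed
  have "k = 0" if "loop_class g [^]\<^bsub>H1\<^esub> k = \<one>\<^bsub>H1\<^esub>" for k :: int
    using loop_class_one_imp_character_zero[OF \<tau>, of "g [^] k"] that g ipow[of k]
    by (simp add: loop_class_int_pow)
  then have "abelian_rank H1 = 1"
    using N g by (intro abelian_rank_eq_1[OF abelian_homology_group, of "loop_class g"])
      (auto simp: loop_class_closed carrier_H1)
  then show ?thesis
    by (simp add: betti_number_def)
qed

end

section \<open>The lattice of the Inoue surface\<close>

text \<open>The witness is \<open>l\<close> times the adjugate of \<open>P\<close>: Cramer's rule
  without division, valid over the integers. With \<open>det m = 1\<close> it inverts
  \<open>m\<close>; for \<open>m - mat 1\<close> it puts all multiples by the determinant into the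
  image.\<close>

lemma cramer_row_3:
  fixes P :: "'a::comm_ring_1^3^3"
  obtains k where "\<And>i. (\<Sum>j\<in>UNIV. k $ j * P $ j $ i) = det P * l $ i"
proof
  define k :: "'a^3" where "k = vector
     [l$1 * (P$2$2 * P$3$3 - P$2$3 * P$3$2) - l$2 * (P$2$1 * P$3$3 - P$2$3 * P$3$1) + l$3 * (P$2$1 * P$3$2 - P$2$2 * P$3$1),
      - l$1 * (P$1$2 * P$3$3 - P$1$3 * P$3$2) + l$2 * (P$1$1 * P$3$3 - P$1$3 * P$3$1) - l$3 * (P$1$1 * P$3$2 - P$1$2 * P$3$1),
      l$1 * (P$1$2 * P$2$3 - P$1$3 * P$2$2) - l$2 * (P$1$1 * P$2$3 - P$1$3 * P$2$1) + l$3 * (P$1$1 * P$2$2 - P$1$2 * P$2$1)]"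
  have "\<forall>i. (\<Sum>j\<in>UNIV. k $ j * P $ j $ i) = det P * l $ i"
    unfolding forall_3 by (simp add: sum_3 det_3 k_def algebra_simps)
  then show "(\<Sum>j\<in>UNIV. k $ j * P $ j $ i) = det P * l $ i" for i
    by blast
qed

lemma surj_linear_if_inj:
  fixes f :: "'a::euclidean_space \<Rightarrow> 'b::euclidean_space"
  assumes "linear f" "inj f" "DIM('a) = DIM('b)"
  shows "surj f"
proof -
  have "dim (range f) = DIM('b)"
    using dim_image_eq[OF assms(1), of UNIV] assms by simp
  then show ?thesis
    using assms(1) by (metis dim_eq_full linear_subspace_image span_eq_iff subspace_UNIV)
qed

text \<open>The real independence of the vectors (c_j, \<alpha>_j) is derived from the eigenvector
  equations in \<open>inj_lat\<close>.\<close>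

locale inoue_data =
  fixes m :: "int^3^3" and c :: real and \<alpha> :: complex
    and cv :: "real^3" and av :: "complex^3"
  assumes det_m: "det m = 1"
    and \<alpha>_nonreal: "\<alpha> \<notin> \<real>" and c_gt_1: "c > 1"
    and cv_nonzero: "cv \<noteq> 0" and cv_eigen: "map_matrix real_of_int m *v cv = c *s cv"
    and av_nonzero: "av \<noteq> 0" and av_eigen: "map_matrix complex_of_int m *v av = \<alpha> *s av"
begin

lemma c_pos: "c > 0"
  using c_gt_1 by simp

lemma \<alpha>_nonzero: "\<alpha> \<noteq> 0"
  using \<alpha>_nonreal by auto

lemma cv_row: "(\<Sum>i\<in>UNIV. of_int (m $ j $ i) * cv $ i) = c * cv $ j"
  using arg_cong[OF cv_eigen, of "\<lambda>v. v $ j"] by (simp add: matrix_vector_mult_def map_matrix_def)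

lemma av_row: "(\<Sum>i\<in>UNIV. of_int (m $ j $ i) * av $ i) = \<alpha> * av $ j"
  using arg_cong[OF av_eigen, of "\<lambda>v. v $ j"] by (simp add: matrix_vector_mult_def map_matrix_def)

text \<open>Taken on real vectors: its injectivity gives discreteness of the integral span, and its
  surjectivity a compact set of representatives.\<close>

definition lat :: "real^3 \<Rightarrow> real \<times> complex" where
  "lat k = (\<Sum>j\<in>UNIV. k $ j *\<^sub>R (cv $ j, av $ j))"

lemma lat_eq: "lat k = (\<Sum>j\<in>UNIV. k $ j * cv $ j, \<Sum>j\<in>UNIV. of_real (k $ j) * av $ j)"
  by (simp add: lat_def sum_prod scaleR_conv_of_real)

lemma linear_lat: "linear lat"
  by (rule linearI) (simp_all add: lat_def scaleR_left_distrib sum.distrib scaleR_sum_right del: scaleR_Pair)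

text \<open>If \<open>a cv + Re (\<beta> av) = 0\<close>, applying \<open>m\<close> and subtracting \<open>c\<close> times the relation removes
  \<open>cv\<close>; applying \<open>m\<close> once more forces \<open>\<beta> = 0\<close>.\<close>

lemma real_eigenvectors_independent:
  assumes "\<And>j. a * cv $ j + Re (\<beta> * av $ j) = 0"
  shows "a = 0 \<and> \<beta> = 0"
proof -
  have apply_m: "Re (\<gamma> * \<alpha> * av $ j) = (\<Sum>i\<in>UNIV. of_int (m $ j $ i) * Re (\<gamma> * av $ i))" for \<gamma> j
  proof -
    have "\<gamma> * \<alpha> * av $ j = (\<Sum>i\<in>UNIV. of_int (m $ j $ i) * (\<gamma> * av $ i))"
      unfolding mult.assoc av_row[symmetric] by (simp add: sum_distrib_left algebra_simps)
    then show ?thesis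
      by (simp add: Re_sum)
  qed
  define \<gamma> where "\<gamma> = \<beta> * (\<alpha> - c)"
  have 1: "Re (\<gamma> * av $ j) = 0" for j
  proof -
    have "a * (c * cv $ j) + Re (\<beta> * \<alpha> * av $ j) =
        (\<Sum>i\<in>UNIV. of_int (m $ j $ i) * (a * cv $ i + Re (\<beta> * av $ i)))"
      unfolding apply_m cv_row[symmetric] by (simp add: sum_3 algebra_simps)
    then have "a * (c * cv $ j) + Re (\<beta> * \<alpha> * av $ j) = 0"
      using assms by simp
    moreover have "c * (a * cv $ j + Re (\<beta> * av $ j)) = 0"
      using assms by simp
    ultimately show ?thesis
      by (simp add: \<gamma>_def algebra_simps)
  qed
  have 2: "Re (\<gamma> * \<alpha> * av $ j) = 0" for j
    unfolding apply_m using 1 by simp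
  have "Im \<alpha> \<noteq> 0"
    using \<alpha>_nonreal complex_is_Real_iff by blast
  \<comment> \<open>A complex number with real part 0 whose product with the non-real \<alpha> also
    has real part 0 must vanish.\<close>
  have "\<gamma> * av $ j = 0" for j
  proof -
    have "Re ((\<gamma> * av $ j) * \<alpha>) = 0"
      using 2[of j] by (simp only: mult_ac)
    then have "Im (\<gamma> * av $ j) * Im \<alpha> = 0"
      using 1[of j] by (simp only: times_complex.sel)
    then show ?thesis
      using 1[of j] \<open>Im \<alpha> \<noteq> 0\<close> by (simp add: complex_eq_iff)
  qed
  moreover obtain j where "av $ j \<noteq> 0"
    using av_nonzero by (auto simp: vec_eq_iff)
  ultimately have "\<gamma> = 0"
    by (metis mult_eq_0_iff)
  moreover have "\<alpha> \<noteq> of_real c"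
    using \<alpha>_nonreal by auto
  ultimately have "\<beta> = 0"
    by (simp add: \<gamma>_def)
  moreover obtain j where "cv $ j \<noteq> 0"
    using cv_nonzero by (auto simp: vec_eq_iff)
  ultimately show ?thesis
    using assms[of j] by simp
qed

text \<open>Real independence of \<open>cv\<close>, Re \<open>av\<close> and Im \<open>av\<close> is
  injectivity of the transpose of \<open>A\<close>; for a square matrix this passes to
  \<open>A\<close>, and \<open>A *v k\<close> lists the real coordinates of
  \<open>lat k\<close>.\<close>

lemma inj_lat: "inj lat"
proof -
  define A :: "real^3^3" where "A = vector [cv, (\<chi> j. Re (av $ j)), (\<chi> j. Im (av $ j))]"
  have A: "A $ 1 = cv" "A $ 2 = (\<chi> j. Re (av $ j))" "A $ 3 = (\<chi> j. Im (av $ j))"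
    by (simp_all add: A_def)
  have "x = 0" if "transpose A *v x = 0" for x
  proof -
    \<comment> \<open>Re ((p - i q) z) = p Re z + q Im z, which explains the minus sign in the
      imaginary part.\<close>
    have "x $ 1 * cv $ j + Re (Complex (x $ 2) (- x $ 3) * av $ j) = 0" for j
      using arg_cong[OF that, of "\<lambda>v. v $ j"]
      by (simp add: matrix_vector_mult_def transpose_def sum_3 A algebra_simps)
    then have "x $ 1 = 0 \<and> Complex (x $ 2) (- x $ 3) = 0"
      by (rule real_eigenvectors_independent)
    then show ?thesis
      by (simp add: vec_eq_iff forall_3 complex_eq_iff)
  qed
  then have "invertible (transpose A)"
    unfolding invertible_left_inverse matrix_left_invertible_ker by blast
  then have "invertible A"
    using transpose_invertible by fastforce
  then have inj_A: "A *v x = 0 \<Longrightarrow> x = 0" for x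
    unfolding invertible_left_inverse matrix_left_invertible_ker by blast
  have "k = 0" if "lat k = 0" for k
  proof (rule inj_A)
    have *: "(\<Sum>j\<in>UNIV. k $ j * cv $ j) = 0" "(\<Sum>j\<in>UNIV. of_real (k $ j) * av $ j) = 0"
      using that by (auto simp: lat_eq zero_prod_def)
    have "(\<Sum>j\<in>UNIV. k $ j * Re (av $ j)) = 0" "(\<Sum>j\<in>UNIV. k $ j * Im (av $ j)) = 0"
      using arg_cong[OF *(2), of Re] arg_cong[OF *(2), of Im] by simp_all
    then show "A *v k = 0"
      using *(1) by (simp add: vec_eq_iff forall_3 matrix_vector_mult_def A mult.commute)
  qed
  then show ?thesis
    using linear_injective_0[OF linear_lat] by blast
qed

lemma surj_lat: "surj lat"
  by (rule surj_linear_if_inj[OF linear_lat inj_lat]) simp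

definition int_lat :: "int^3 \<Rightarrow> real \<times> complex" where
  "int_lat k = lat (\<chi> j. of_int (k $ j))"

lemma int_lat_add: "int_lat (k + l) = int_lat k + int_lat l"
  unfolding int_lat_def by (subst linear_add[OF linear_lat, symmetric]) (simp add: vec_eq_iff arg_cong[where f = lat])

lemma int_lat_diff: "int_lat (k - l) = int_lat k - int_lat l"
  using int_lat_add[of "k - l" l] by (simp add: algebra_simps)

lemma int_lat_0: "int_lat 0 = 0"
  using int_lat_add[of 0 0] by simp

lemma int_lat_minus: "int_lat (- k) = - int_lat k"
  using int_lat_diff[of 0 k] by (simp add: int_lat_0)

section \<open>The action of the first coordinate on the lattice\<close>

definition act :: "real \<Rightarrow> real \<times> complex \<Rightarrow> real \<times> complex" where
  "act t = (\<lambda>(u, z). (c powr t * u, \<alpha> powr of_real t * z))"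

lemma act_add: "act (s + t) v = act s (act t v)"
  using c_pos \<alpha>_nonzero by (simp add: act_def split_def powr_add)

lemma act_0: "act 0 v = v"
  using c_pos \<alpha>_nonzero by (simp add: act_def split_def)

lemma linear_act: "linear (act t)"
  by (rule linearI) (auto simp: act_def algebra_simps)

text \<open>The eigenvector equations turn multiplication by \<open>c\<close> and
  \<open>\<alpha>\<close> into the row vector \<open>k\<close> times \<open>m\<close>, whence the
  sum over the first index.\<close>

lemma act_1_int_lat: "act 1 (int_lat k) = int_lat (\<chi> i. \<Sum>j\<in>UNIV. k $ j * m $ j $ i)"
proof -
  have "c * (\<Sum>j\<in>UNIV. of_int (k $ j) * cv $ j) =
      (\<Sum>i\<in>UNIV. of_int (\<Sum>j\<in>UNIV. k $ j * m $ j $ i) * cv $ i)"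
  proof -
    have "c * (\<Sum>j\<in>UNIV. of_int (k $ j) * cv $ j) = (\<Sum>j\<in>UNIV. of_int (k $ j) * (c * cv $ j))"
      by (simp add: sum_distrib_left algebra_simps)
    also have "\<dots> = (\<Sum>i\<in>UNIV. of_int (\<Sum>j\<in>UNIV. k $ j * m $ j $ i) * cv $ i)"
      unfolding cv_row[symmetric] by (simp add: sum_3 algebra_simps)
    finally show ?thesis .
  qed
  moreover have "\<alpha> * (\<Sum>j\<in>UNIV. of_int (k $ j) * av $ j) =
      (\<Sum>i\<in>UNIV. of_int (\<Sum>j\<in>UNIV. k $ j * m $ j $ i) * av $ i)"
  proof -
    have "\<alpha> * (\<Sum>j\<in>UNIV. of_int (k $ j) * av $ j) = (\<Sum>j\<in>UNIV. of_int (k $ j) * (\<alpha> * av $ j))"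
      by (simp add: sum_distrib_left algebra_simps)
    also have "\<dots> = (\<Sum>i\<in>UNIV. of_int (\<Sum>j\<in>UNIV. k $ j * m $ j $ i) * av $ i)"
      unfolding av_row[symmetric] by (simp add: sum_3 algebra_simps)
    finally show ?thesis .
  qed
  ultimately show ?thesis
    using c_pos \<alpha>_nonzero by (simp add: int_lat_def lat_eq act_def)
qed

text \<open>Cramer's solution is integral because \<open>det m = 1\<close>; this lets negative
  powers preserve the lattice.\<close>

lemma act_1_int_lat_surj: "\<exists>l. act 1 (int_lat l) = int_lat k"
proof -
  obtain l where "\<And>i. (\<Sum>j\<in>UNIV. l $ j * m $ j $ i) = det m * k $ i"
    using cramer_row_3[of m k] by blast
  then have "act 1 (int_lat l) = int_lat k"
    unfolding act_1_int_lat by (intro arg_cong[of _ _ int_lat]) (simp add: vec_eq_iff det_m)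
  then show ?thesis ..
qed

lemma act_int_in_range: "act (of_int n) (int_lat k) \<in> range int_lat"
proof (induction n arbitrary: k rule: int_induct[where k = 0])
  case base
  show ?case by (simp add: act_0)
next
  case (step1 i)
  have "act (of_int (i + 1)) (int_lat k) = act (of_int i) (act 1 (int_lat k))"
    by (simp flip: act_add)
  then show ?case
    unfolding act_1_int_lat using step1 by simp
next
  case (step2 i)
  obtain l where "act 1 (int_lat l) = int_lat k"
    using act_1_int_lat_surj by blast
  then have "act (of_int (i - 1)) (int_lat k) = act (of_int i) (int_lat l)"
    by (metis act_add add.commute diff_add_cancel of_int_1 of_int_add)
  then show ?case
    using step2 by simp
qed

text \<open>A real row vector fixed by \<open>m\<close> pairs with \<open>cv\<close> to a number
  fixed under multiplication by \<open>c\<close>, and with \<open>av\<close> to one fixed under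
  multiplication by \<open>\<alpha>\<close>. Both are 0, so \<open>lat\<close> kills the
  vector.\<close>

lemma det_m_minus_1: "det (m - mat 1) \<noteq> 0"
proof
  assume 0: "det (m - mat 1) = 0"
  define P where "P = map_matrix real_of_int (m - mat 1)"
  have "det P = of_int (det (m - mat 1))"
    by (simp add: P_def det_3 map_matrix_def)
  then have "det (transpose P) = 0"
    using 0 by (simp add: det_transpose)
  then obtain k where k: "transpose P *v k = 0" "k \<noteq> 0"
    by (metis invertible_det_nz invertible_left_inverse matrix_left_invertible_ker)
  have k_row: "(\<Sum>j\<in>UNIV. k $ j * of_int (m $ j $ i)) = k $ i" for i
    using arg_cong[OF k(1), of "\<lambda>v. v $ i"] exhaust_3[of i]
    by (auto simp: matrix_vector_mult_def transpose_def P_def map_matrix_def mat_def sum_3 algebra_simps)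
  have "(\<Sum>i\<in>UNIV. k $ i * cv $ i) = c * (\<Sum>i\<in>UNIV. k $ i * cv $ i)"
  proof -
    have "(\<Sum>i\<in>UNIV. k $ i * cv $ i) = (\<Sum>i\<in>UNIV. (\<Sum>j\<in>UNIV. k $ j * of_int (m $ j $ i)) * cv $ i)"
      unfolding k_row ..
    also have "\<dots> = (\<Sum>j\<in>UNIV. k $ j * (\<Sum>i\<in>UNIV. of_int (m $ j $ i) * cv $ i))"
      by (simp add: sum_3 algebra_simps)
    also have "\<dots> = c * (\<Sum>i\<in>UNIV. k $ i * cv $ i)"
      unfolding cv_row by (simp only: sum_distrib_left mult.left_commute)
    finally show ?thesis .
  qed
  then have 1: "(\<Sum>i\<in>UNIV. k $ i * cv $ i) = 0"
    using c_gt_1 by simp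
  have "(\<Sum>i\<in>UNIV. of_real (k $ i) * av $ i) = \<alpha> * (\<Sum>i\<in>UNIV. of_real (k $ i) * av $ i)"
  proof -
    have "(\<Sum>i\<in>UNIV. of_real (k $ i) * av $ i) =
        (\<Sum>i\<in>UNIV. of_real (\<Sum>j\<in>UNIV. k $ j * of_int (m $ j $ i)) * av $ i)"
      unfolding k_row ..
    also have "\<dots> = (\<Sum>j\<in>UNIV. of_real (k $ j) * (\<Sum>i\<in>UNIV. of_int (m $ j $ i) * av $ i))"
      by (simp add: sum_3 algebra_simps)
    also have "\<dots> = \<alpha> * (\<Sum>i\<in>UNIV. of_real (k $ i) * av $ i)"
      unfolding av_row by (simp only: sum_distrib_left mult.left_commute)
    finally show ?thesis .
  qed
  then have "(\<Sum>i\<in>UNIV. of_real (k $ i) * av $ i) = 0"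
    using \<alpha>_nonreal by auto
  with 1 have "lat k = lat 0"
    by (simp add: lat_eq linear_0[OF linear_lat] zero_prod_def)
  then show False
    using inj_lat k(2) by (simp add: inj_eq)
qed

text \<open>The form \<open>act 1 v - v\<close> is the one that becomes trivial once conjugate
  elements are identified.\<close>

lemma det_m_minus_1_multiple:
  obtains l where "int_lat (det (m - mat 1) *s k) = act 1 (int_lat l) - int_lat l"
proof -
  obtain l where l: "\<And>i. (\<Sum>j\<in>UNIV. l $ j * (m - mat 1) $ j $ i) = det (m - mat 1) * k $ i"
    using cramer_row_3[of "m - mat 1" k] by blast
  have "(\<Sum>j\<in>UNIV. l $ j * m $ j $ i) - l $ i = det (m - mat 1) * k $ i" for i
    unfolding l[symmetric] using exhaust_3[of i] by (auto simp: mat_def sum_3 algebra_simps)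
  then have "int_lat (det (m - mat 1) *s k) = int_lat ((\<chi> i. \<Sum>j\<in>UNIV. l $ j * m $ j $ i) - l)"
    by (intro arg_cong[of _ _ int_lat]) (simp add: vec_eq_iff)
  then show thesis
    using that[of l] by (simp add: int_lat_diff act_1_int_lat)
qed

end

section \<open>The discrete subgroups\<close>

lemma of_int_scaleR_closed:
  fixes X :: "'a::real_vector set"
  assumes "0 \<in> X" "\<And>x y. x \<in> X \<Longrightarrow> y \<in> X \<Longrightarrow> x + y \<in> X" "\<And>x. x \<in> X \<Longrightarrow> - x \<in> X" "b \<in> X"
  shows "of_int n *\<^sub>R b \<in> X"
proof (induction n rule: int_induct[where k = 0])
  case (step1 i)
  then show ?case using assms(2)[OF step1(2) assms(4)] by (simp add: scaleR_left_distrib)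
next
  case (step2 i)
  then show ?case using assms(2)[OF step2(2) assms(3)[OF assms(4)]] by (simp add: scaleR_left_diff_distrib)
qed (use assms in auto)

section \<open>Gaussian integers and quarter turns\<close>

lemma gauss_lattice_0: "0 \<in> gauss_lattice"
  unfolding gauss_lattice_def by (auto intro: exI[of _ 0])

lemma gauss_lattice_add: "v \<in> gauss_lattice \<Longrightarrow> w \<in> gauss_lattice \<Longrightarrow> v + w \<in> gauss_lattice"
proof -
  assume "v \<in> gauss_lattice" "w \<in> gauss_lattice"
  then obtain a b a' b' :: int where "v = of_int a + \<i> * of_int b" "w = of_int a' + \<i> * of_int b'"
    by (auto simp: gauss_lattice_def)
  then have "v + w = of_int (a + a') + \<i> * of_int (b + b')"
    by (simp add: algebra_simps)
  then show ?thesis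
    unfolding gauss_lattice_def by blast
qed

lemma gauss_lattice_minus: "w \<in> gauss_lattice \<Longrightarrow> - w \<in> gauss_lattice"
proof -
  assume "w \<in> gauss_lattice"
  then obtain a b :: int where "w = of_int a + \<i> * of_int b"
    by (auto simp: gauss_lattice_def)
  then have "- w = of_int (- a) + \<i> * of_int (- b)"
    by simp
  then show ?thesis
    unfolding gauss_lattice_def by blast
qed

lemma gauss_lattice_\<i>: "w \<in> gauss_lattice \<Longrightarrow> \<i> * w \<in> gauss_lattice"
proof -
  assume "w \<in> gauss_lattice"
  then obtain a b :: int where "w = of_int a + \<i> * of_int b"
    by (auto simp: gauss_lattice_def)
  then have "\<i> * w = of_int (- b) + \<i> * of_int a"
    by (simp add: algebra_simps)
  then show ?thesis
    unfolding gauss_lattice_def by blast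
qed

lemma gauss_lattice_norm_less_1:
  assumes "w \<in> gauss_lattice" "norm w < 1"
  shows "w = 0"
proof -
  obtain a b :: int where w: "w = of_int a + \<i> * of_int b"
    using assms by (auto simp: gauss_lattice_def)
  have "\<bar>Re w\<bar> < 1" "\<bar>Im w\<bar> < 1"
    using assms(2) abs_Re_le_cmod[of w] abs_Im_le_cmod[of w] by linarith+
  then have "\<bar>a\<bar> < 1" "\<bar>b\<bar> < 1"
    unfolding w by auto
  then show ?thesis
    by (simp add: w)
qed

definition rot :: "real \<Rightarrow> complex" where
  "rot t = exp (\<i> * of_real (pi / 2) * of_real t)"

lemma rot_add: "rot (s + t) = rot s * rot t"
  by (simp add: rot_def algebra_simps exp_add add_divide_distrib)

lemma rot_0: "rot 0 = 1"
  by (simp add: rot_def)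

lemma rot_1: "rot 1 = \<i>"
  using cis_conv_exp[of "pi / 2"] by (simp add: rot_def)

lemma rot_int_gauss: "w \<in> gauss_lattice \<Longrightarrow> rot (of_int n) * w \<in> gauss_lattice"
proof (induction n arbitrary: w rule: int_induct[where k = 0])
  case (step1 i)
  then show ?case
    using gauss_lattice_\<i> by (simp add: rot_add rot_1 mult.assoc)
next
  case (step2 i)
  have "rot (of_int (i - 1)) * \<i> = rot (of_int i)"
    using rot_add[of "of_int (i - 1)" 1] by (simp add: rot_1)
  \<comment> \<open>In the downward step, dividing by \<i> is multiplication by - \<i>, which again
    preserves the lattice.\<close>
  then have "rot (of_int (i - 1)) * w = rot (of_int i) * (- (\<i> * w))"
    by (metis (no_types, lifting) minus_mult_right mult.assoc mult_minus1 i_squared minus_minus mult_1)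
  then show ?case
    using step2 gauss_lattice_\<i> gauss_lattice_minus by metis
qed (simp add: rot_0)

context inoue_data
begin

abbreviation "S6 \<equiv> S_group c \<alpha>"
abbreviation "\<Gamma> \<equiv> \<Gamma>_lattice c \<alpha> cv av"
abbreviation "S4 \<equiv> inoue_group c \<alpha>"
abbreviation "\<Lambda> \<equiv> inoue_lattice c \<alpha> cv av"

text \<open>The coordinates \<open>u\<close> and \<open>z\<close> form one vector, on which
  \<open>act\<close> and \<open>lat\<close> operate.\<close>

definition elt :: "real \<Rightarrow> real \<times> complex \<Rightarrow> complex \<Rightarrow> real \<times> real \<times> complex \<times> complex" where
  "elt t v w = (t, fst v, snd v, w)"

lemma elt_cases: obtains t v w where "x = elt t v w"
  unfolding elt_def by (metis fst_conv prod_cases4 snd_conv)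

lemma elt_eq_iff: "elt t v w = elt t' v' w' \<longleftrightarrow> t = t' \<and> v = v' \<and> w = w'"
  by (auto simp: elt_def prod_eq_iff)

lemma S6_mult: "elt t v w \<otimes>\<^bsub>S6\<^esub> elt t' v' w' = elt (t + t') (act t v' + v) (rot t * w' + w)"
  by (simp add: S_group_def elt_def act_def rot_def split_def)

lemma S6_one: "\<one>\<^bsub>S6\<^esub> = elt 0 0 0"
  by (simp add: S_group_def elt_def)

lemma S4_mult: "(t, v) \<otimes>\<^bsub>S4\<^esub> (t', v') = (t + t', act t v' + v)"
  by (simp add: inoue_group_def act_def split_def prod_eq_iff)

lemma S4_one: "\<one>\<^bsub>S4\<^esub> = (0, 0)"
  by (simp add: inoue_group_def zero_prod_def)

sublocale S6: group S6
  using group_S_group c_pos \<alpha>_nonzero .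

sublocale S4: group S4
  using group_inoue_group c_pos \<alpha>_nonzero .

lemma carrier_S6 [simp]: "carrier S6 = UNIV"
  by (simp add: S_group_def)

lemma carrier_S4 [simp]: "carrier S4 = UNIV"
  by (simp add: inoue_group_def)

lemma act_zero: "act t 0 = 0"
  using linear_0[OF linear_act] .

lemma S6_inv: "inv\<^bsub>S6\<^esub> (elt t v w) = elt (- t) (- act (- t) v) (- (rot (- t) * w))"
  by (rule S6.inv_equality) (auto simp: S6_mult S6_one)

lemma S4_inv: "inv\<^bsub>S4\<^esub> (t, v) = (- t, - act (- t) v)"
  by (rule S4.inv_equality) (auto simp: S4_mult S4_one)

lemma int_lat_axis: "int_lat (axis j 1) = (cv $ j, av $ j)"
proof -
  have "int_lat (axis j 1) = (\<Sum>i\<in>UNIV. if i = j then (cv $ i, av $ i) else 0)"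
    unfolding int_lat_def lat_def by (intro sum.cong) (auto simp: axis_def zero_prod_def)
  then show ?thesis
    by simp
qed

lemma subgroup_\<Gamma>: "subgroup \<Gamma> S6"
  unfolding \<Gamma>_lattice_def by (rule S6.generate_is_subgroup) auto

text \<open>An explicit normal form that replaces induction over \<open>generate\<close>;
  \<open>\<Gamma>_eq\<close> identifies the two groups.\<close>

definition std_\<Gamma> :: "(real \<times> real \<times> complex \<times> complex) set" where
  "std_\<Gamma> = {elt (of_int n) (int_lat k) w |n k w. w \<in> gauss_lattice}"

lemma subgroup_std_\<Gamma>: "subgroup std_\<Gamma> S6"
proof
  show "\<one>\<^bsub>S6\<^esub> \<in> std_\<Gamma>"
    unfolding std_\<Gamma>_def S6_one using gauss_lattice_0 int_lat_0 by (metis (mono_tags, lifting) mem_Collect_eq of_int_0)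
next
  fix x y assume "x \<in> std_\<Gamma>" "y \<in> std_\<Gamma>"
  then obtain n k w n' k' w' where x: "x = elt (of_int n) (int_lat k) w" "w \<in> gauss_lattice"
    and y: "y = elt (of_int n') (int_lat k') w'" "w' \<in> gauss_lattice"
    unfolding std_\<Gamma>_def by blast
  obtain l where "act (of_int n) (int_lat k') = int_lat l"
    using act_int_in_range by blast
  then have "x \<otimes>\<^bsub>S6\<^esub> y = elt (of_int (n + n')) (int_lat (l + k)) (rot (of_int n) * w' + w)"
    by (simp add: x y S6_mult int_lat_add)
  then show "x \<otimes>\<^bsub>S6\<^esub> y \<in> std_\<Gamma>"
    unfolding std_\<Gamma>_def using x y gauss_lattice_add rot_int_gauss by blast
next
  fix x assume "x \<in> std_\<Gamma>"
  then obtain n k w where x: "x = elt (of_int n) (int_lat k) w" "w \<in> gauss_lattice"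
    unfolding std_\<Gamma>_def by blast
  obtain l where "act (of_int (- n)) (int_lat k) = int_lat l"
    using act_int_in_range by blast
  then have "inv\<^bsub>S6\<^esub> x = elt (of_int (- n)) (int_lat (- l)) (- (rot (of_int (- n)) * w))"
    by (simp add: x S6_inv int_lat_minus)
  then show "inv\<^bsub>S6\<^esub> x \<in> std_\<Gamma>"
    unfolding std_\<Gamma>_def using x gauss_lattice_minus rot_int_gauss by blast
qed auto

lemma elt_int_in_\<Gamma>: "elt (of_int n) 0 0 \<in> \<Gamma>"
proof -
  have g0: "elt 1 0 0 \<in> \<Gamma>"
    unfolding \<Gamma>_lattice_def by (rule generate.incl) (simp add: elt_def)
  show ?thesis
  proof (induction n rule: int_induct[where k = 0])
    case base
    show ?case using subgroup.one_closed[OF subgroup_\<Gamma>] by (simp add: S6_one)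
  next
    case (step1 i)
    then show ?case
      using subgroup.m_closed[OF subgroup_\<Gamma> g0 step1(2)] by (simp add: S6_mult act_zero add.commute)
  next
    case (step2 i)
    then show ?case
      using subgroup.m_closed[OF subgroup_\<Gamma> subgroup.m_inv_closed[OF subgroup_\<Gamma> g0] step2(2)]
      by (simp add: S6_mult S6_inv act_zero)
  qed
qed

lemma elt_lat_in_\<Gamma>: "elt 0 (int_lat k) 0 \<in> \<Gamma>"
proof -
  define X where "X = {v. elt 0 v 0 \<in> \<Gamma>}"
  have X: "0 \<in> X" "\<And>x y. x \<in> X \<Longrightarrow> y \<in> X \<Longrightarrow> x + y \<in> X" "\<And>x. x \<in> X \<Longrightarrow> - x \<in> X"
    unfolding X_def mem_Collect_eq
    subgoal using subgroup.one_closed[OF subgroup_\<Gamma>] by (simp add: S6_one)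
    subgoal for x y using subgroup.m_closed[OF subgroup_\<Gamma>, of "elt 0 x 0" "elt 0 y 0"]
      by (simp add: S6_mult act_0 rot_0 add.commute)
    subgoal for x using subgroup.m_inv_closed[OF subgroup_\<Gamma>, of "elt 0 x 0"]
      by (simp add: S6_inv act_0 rot_0)
    done
  have "(cv $ j, av $ j) \<in> X" for j
    unfolding X_def \<Gamma>_lattice_def by (auto intro!: generate.incl simp: elt_def)
  then have "of_int (k $ j) *\<^sub>R (cv $ j, av $ j) \<in> X" for j
    using of_int_scaleR_closed X by blast
  then have "int_lat k \<in> X"
    unfolding int_lat_def lat_def sum_3 by (simp add: X(2) del: scaleR_Pair add_Pair)
  then show ?thesis
    by (simp add: X_def)
qed

lemma elt_gauss_in_\<Gamma>: "w \<in> gauss_lattice \<Longrightarrow> elt 0 0 w \<in> \<Gamma>"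
proof -
  assume "w \<in> gauss_lattice"
  then obtain a b :: int where w: "w = of_int a *\<^sub>R 1 + of_int b *\<^sub>R \<i>"
    by (auto simp: gauss_lattice_def scaleR_conv_of_real mult.commute)
  define X where "X = {w. elt 0 0 w \<in> \<Gamma>}"
  have X: "0 \<in> X" "\<And>x y. x \<in> X \<Longrightarrow> y \<in> X \<Longrightarrow> x + y \<in> X" "\<And>x. x \<in> X \<Longrightarrow> - x \<in> X"
    unfolding X_def mem_Collect_eq
    subgoal using subgroup.one_closed[OF subgroup_\<Gamma>] by (simp add: S6_one)
    subgoal for x y using subgroup.m_closed[OF subgroup_\<Gamma>, of "elt 0 0 x" "elt 0 0 y"]
      by (simp add: S6_mult act_0 rot_0 add.commute)
    subgoal for x using subgroup.m_inv_closed[OF subgroup_\<Gamma>, of "elt 0 0 x"]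
      by (simp add: S6_inv act_0 rot_0)
    done
  have "1 \<in> X" "\<i> \<in> X"
    unfolding X_def \<Gamma>_lattice_def by (auto intro!: generate.incl simp: elt_def)
  then have "w \<in> X"
    unfolding w by (intro X(2) of_int_scaleR_closed[of X, OF X])
  then show ?thesis
    by (simp add: X_def)
qed

text \<open>With the first coordinate in the last factor, neither \<open>act\<close> nor
  \<open>rot\<close> twists the other entries.\<close>

lemma elt_decompose: "elt t v w = elt 0 v 0 \<otimes>\<^bsub>S6\<^esub> (elt 0 0 w \<otimes>\<^bsub>S6\<^esub> elt t 0 0)"
  by (simp add: S6_mult act_0 rot_0)

lemma \<Gamma>_eq: "\<Gamma> = std_\<Gamma>"
proof
  show "\<Gamma> \<subseteq> std_\<Gamma>"
    unfolding \<Gamma>_lattice_def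
  proof (rule S6.generate_subgroup_incl[OF _ subgroup_std_\<Gamma>])
    have "(1, 0, 0, 0) = elt (of_int 1) (int_lat 0) 0" "(0, cv $ j, av $ j, 0) = elt (of_int 0) (int_lat (axis j 1)) 0"
      "(0, 0, 0, w) = elt (of_int 0) (int_lat 0) w" for j w
      by (auto simp: elt_def int_lat_axis int_lat_0)
    moreover have "1 \<in> gauss_lattice" "\<i> \<in> gauss_lattice"
      unfolding gauss_lattice_def by (force intro: exI[of _ 0] exI[of _ 1])+
    ultimately show "{(1, 0, 0, 0)} \<union> range (\<lambda>j. (0, cv $ j, av $ j, 0)) \<union> {(0, 0, 0, 1), (0, 0, 0, \<i>)} \<subseteq> std_\<Gamma>"
      unfolding std_\<Gamma>_def using gauss_lattice_0 by blast
  qed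
  show "std_\<Gamma> \<subseteq> \<Gamma>"
    unfolding std_\<Gamma>_def
    using elt_decompose subgroup.m_closed[OF subgroup_\<Gamma>] elt_gauss_in_\<Gamma> elt_int_in_\<Gamma> elt_lat_in_\<Gamma>
    by (smt (verit, ccfv_SIG) mem_Collect_eq subsetI)
qed

definition forget :: "real \<times> real \<times> complex \<times> complex \<Rightarrow> real \<times> real \<times> complex" where
  "forget = (\<lambda>(t, u, z, w). (t, u, z))"

lemma forget_elt: "forget (elt t v w) = (t, v)"
  by (simp add: forget_def elt_def)

lemma forget_mult: "forget (x \<otimes>\<^bsub>S6\<^esub> y) = forget x \<otimes>\<^bsub>S4\<^esub> forget y"
  by (cases x rule: elt_cases, cases y rule: elt_cases) (simp add: S6_mult S4_mult forget_elt)

lemma subgroup_\<Lambda>: "subgroup \<Lambda> S4"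
  unfolding inoue_lattice_def by (rule S4.generate_is_subgroup) auto

text \<open>Forgetting the last coordinate sends generators to generators or, for the two Gaussian
  ones, to the identity; both inclusions follow by comparing generators.\<close>

lemma \<Lambda>_eq: "\<Lambda> = forget ` \<Gamma>"
proof
  interpret forget: group_hom S6 S4 forget
    by unfold_locales (auto simp: hom_def forget_mult)
  show "\<Lambda> \<subseteq> forget ` \<Gamma>"
    unfolding inoue_lattice_def
  proof (rule S4.generate_subgroup_incl[OF _ forget.subgroup_img_is_subgroup[OF subgroup_\<Gamma>]])
    have "(1, 0, 0, 0) \<in> \<Gamma>" "(0, cv $ j, av $ j, 0) \<in> \<Gamma>" for j
      unfolding \<Gamma>_lattice_def by (auto intro!: generate.incl)
    moreover have "(1, 0, 0) = forget (1, 0, 0, 0)" "(0, cv $ j, av $ j) = forget (0, cv $ j, av $ j, 0)" for j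
      by (simp_all add: forget_def)
    ultimately show "{(1, 0, 0)} \<union> range (\<lambda>j. (0, cv $ j, av $ j)) \<subseteq> forget ` \<Gamma>"
      by (metis (no_types, lifting) Un_least empty_subsetI image_eqI image_subsetI insert_subset)
  qed
  have "subgroup {x. forget x \<in> \<Lambda>} S6"
    using subgroup_\<Lambda>
    by unfold_locales (auto simp: forget_mult subgroup.m_closed subgroup.one_closed subgroup.m_inv_closed forget.hom_inv)
  moreover have "{(1, 0, 0, 0)} \<union> range (\<lambda>j. (0, cv $ j, av $ j, 0)) \<union> {(0, 0, 0, 1), (0, 0, 0, \<i>)} \<subseteq> {x. forget x \<in> \<Lambda>}"
    using subgroup.one_closed[OF subgroup_\<Lambda>] unfolding inoue_lattice_def
    by (auto simp: forget_def S4_one zero_prod_def intro!: generate.incl)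
  ultimately have "\<Gamma> \<subseteq> {x. forget x \<in> \<Lambda>}"
    unfolding \<Gamma>_lattice_def by (rule S6.generate_subgroup_incl[rotated])
  then show "forget ` \<Gamma> \<subseteq> \<Lambda>"
    by auto
qed

text \<open>An injective linear map between Euclidean spaces is bounded below, and a nonzero
  integral vector has norm at least 1.\<close>

lemma int_lat_discrete: "\<exists>B>0. \<forall>k. norm (int_lat k) < B \<longrightarrow> k = 0"
proof -
  obtain B where B: "B > 0" "\<And>x. B * norm x \<le> norm (lat x)"
    using linear_inj_bounded_below_pos[OF linear_lat inj_lat] by blast
  have "k = 0" if "norm (int_lat k) < B" for k
  proof -
    let ?x = "(\<chi> j. of_int (k $ j)) :: real^3"
    have "B * norm ?x < B"
      using B(2)[of ?x] that by (simp add: int_lat_def)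
    then have "norm ?x < 1"
      using B(1) by simp
    then have "\<bar>?x $ j\<bar> < 1" for j
      using component_le_norm_cart[of ?x j] by linarith
    then have h: "\<bar>real_of_int (k $ j)\<bar> < 1" for j
      by simp
    have "k $ j = 0" for j
      using h[of j] by linarith
    then show ?thesis
      by (simp add: vec_eq_iff)
  qed
  with B(1) show ?thesis
    by blast
qed

lemma affine_S6: "affine_map (\<lambda>x. g \<otimes>\<^bsub>S6\<^esub> x)"
proof -
  obtain t u z w where g: "g = (t, u, z, w)"
    by (metis prod_cases4)
  have "linear (\<lambda>(t', u', z', w'). (t' :: real, c powr t * u', \<alpha> powr of_real t * z', rot t * w'))"
    by (rule linearI) (auto simp: algebra_simps)
  then show ?thesis
    by (rule affine_mapI[where b = g]) (auto simp: g S_group_def rot_def)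
qed

lemma affine_S4: "affine_map (\<lambda>x. g \<otimes>\<^bsub>S4\<^esub> x)"
proof -
  obtain t u z where g: "g = (t, u, z)"
    by (metis prod_cases3)
  have "linear (\<lambda>(t', u', z'). (t' :: real, c powr t * u', \<alpha> powr of_real t * z'))"
    by (rule linearI) (auto simp: algebra_simps)
  then show ?thesis
    by (rule affine_mapI[where b = g]) (auto simp: g inoue_group_def)
qed

sublocale M6: discrete_affine_subgroup S6 \<Gamma>
proof (intro discrete_affine_subgroup.intro discrete_affine_subgroup_axioms.intro)
  show "Group.group S6" by (rule S6.is_group)
  show "carrier S6 = UNIV" by simp
  show "subgroup \<Gamma> S6" by (rule subgroup_\<Gamma>)
  show "affine_map (\<lambda>x. g \<otimes>\<^bsub>S6\<^esub> x)" for g by (rule affine_S6)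
  show "continuous_on UNIV (\<lambda>(x, y). x \<otimes>\<^bsub>S6\<^esub> y)"
    using c_pos \<alpha>_nonzero unfolding S_group_def
    by (auto simp: split_def powr_def intro!: continuous_intros)
  have "m_inv S6 = (\<lambda>x. (- fst x, - (c powr (- fst x) * fst (snd x)),
      - (\<alpha> powr of_real (- fst x) * fst (snd (snd x))), - (rot (- fst x) * snd (snd (snd x)))))"
  proof
    fix x show "m_inv S6 x = (- fst x, - (c powr (- fst x) * fst (snd x)),
      - (\<alpha> powr of_real (- fst x) * fst (snd (snd x))), - (rot (- fst x) * snd (snd (snd x))))"
      by (cases x rule: elt_cases) (simp add: S6_inv, simp add: elt_def act_def split_def)
  qed
  then show "continuous_on UNIV (m_inv S6)"
    using c_pos \<alpha>_nonzero by (auto simp: powr_def rot_def intro!: continuous_intros)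
  obtain B where B: "B > 0" "\<And>k. norm (int_lat k) < B \<Longrightarrow> k = 0"
    using int_lat_discrete by blast
  \<comment> \<open>Each condition isolates 0 in one of three lattices: the integers,
    \<open>range int_lat\<close> and the Gaussian integers.\<close>
  let ?U = "{x :: real \<times> real \<times> complex \<times> complex. \<bar>fst x\<bar> < 1 \<and>
      norm (fst (snd x), fst (snd (snd x))) < B \<and> norm (snd (snd (snd x))) < 1}"
  have "open ?U"
    by (intro open_Collect_conj open_Collect_less continuous_intros)
  moreover have "?U \<inter> \<Gamma> = {\<one>\<^bsub>S6\<^esub>}"
  proof
    show "?U \<inter> \<Gamma> \<subseteq> {\<one>\<^bsub>S6\<^esub>}"
    proof
      fix x assume x: "x \<in> ?U \<inter> \<Gamma>"
      then obtain n k w where xe: "x = elt (of_int n) (int_lat k) w" "w \<in> gauss_lattice"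
        unfolding \<Gamma>_eq std_\<Gamma>_def by blast
      then have "\<bar>of_int n :: real\<bar> < 1" "norm (int_lat k) < B" "norm w < 1"
        using x by (auto simp: elt_def)
      then have "n = 0" "k = 0" "w = 0"
        using B(2) gauss_lattice_norm_less_1 xe by auto
      then show "x \<in> {\<one>\<^bsub>S6\<^esub>}"
        by (simp add: xe S6_one int_lat_0)
    qed
    show "{\<one>\<^bsub>S6\<^esub>} \<subseteq> ?U \<inter> \<Gamma>"
      using B(1) subgroup.one_closed[OF subgroup_\<Gamma>] by (auto simp: S6_one elt_def)
  qed
  ultimately show "\<exists>U. open U \<and> U \<inter> \<Gamma> = {\<one>\<^bsub>S6\<^esub>}"
    by blast
qed

sublocale M4: discrete_affine_subgroup S4 \<Lambda>
proof (intro discrete_affine_subgroup.intro discrete_affine_subgroup_axioms.intro)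
  show "Group.group S4" by (rule S4.is_group)
  show "carrier S4 = UNIV" by simp
  show "subgroup \<Lambda> S4" by (rule subgroup_\<Lambda>)
  show "affine_map (\<lambda>x. g \<otimes>\<^bsub>S4\<^esub> x)" for g by (rule affine_S4)
  show "continuous_on UNIV (\<lambda>(x, y). x \<otimes>\<^bsub>S4\<^esub> y)"
    using c_pos \<alpha>_nonzero unfolding inoue_group_def
    by (auto simp: split_def powr_def intro!: continuous_intros)
  have "m_inv S4 = (\<lambda>x. (- fst x, - (c powr (- fst x) * fst (snd x)),
      - (\<alpha> powr of_real (- fst x) * snd (snd x))))"
  proof
    fix x show "m_inv S4 x = (- fst x, - (c powr (- fst x) * fst (snd x)), - (\<alpha> powr of_real (- fst x) * snd (snd x)))"
      by (cases x) (simp add: S4_inv, simp add: act_def split_def)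
  qed
  then show "continuous_on UNIV (m_inv S4)"
    using c_pos \<alpha>_nonzero by (auto simp: powr_def intro!: continuous_intros)
  obtain B where B: "B > 0" "\<And>k. norm (int_lat k) < B \<Longrightarrow> k = 0"
    using int_lat_discrete by blast
  let ?U = "{x :: real \<times> real \<times> complex. \<bar>fst x\<bar> < 1 \<and> norm (snd x) < B}"
  have "open ?U"
    by (intro open_Collect_conj open_Collect_less continuous_intros)
  moreover have "?U \<inter> \<Lambda> = {\<one>\<^bsub>S4\<^esub>}"
  proof
    show "?U \<inter> \<Lambda> \<subseteq> {\<one>\<^bsub>S4\<^esub>}"
    proof
      fix x assume x: "x \<in> ?U \<inter> \<Lambda>"
      then obtain n k where xe: "x = (of_int n, int_lat k)"
        unfolding \<Lambda>_eq \<Gamma>_eq std_\<Gamma>_def by (auto simp: forget_elt)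
      then have "\<bar>of_int n :: real\<bar> < 1" "norm (int_lat k) < B"
        using x by auto
      then have "n = 0" "k = 0"
        using B(2) by auto
      then show "x \<in> {\<one>\<^bsub>S4\<^esub>}"
        by (simp add: xe S4_one int_lat_0)
    qed
    show "{\<one>\<^bsub>S4\<^esub>} \<subseteq> ?U \<inter> \<Lambda>"
      using B(1) subgroup.one_closed[OF subgroup_\<Lambda>] by (auto simp: S4_one)
  qed
  ultimately show "\<exists>U. open U \<and> U \<inter> \<Lambda> = {\<one>\<^bsub>S4\<^esub>}"
    by blast
qed

end

lemma subgroup_gauss_lattice: "subgroup gauss_lattice complex_add_group"
proof -
  interpret comm_group complex_add_group by (rule comm_group_complex_add_group)
  have "inv\<^bsub>complex_add_group\<^esub> w = - w" for w
    by (rule inv_equality) (auto simp: complex_add_group_def)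
  then show ?thesis
    by unfold_locales (auto simp: complex_add_group_def gauss_lattice_0 gauss_lattice_add gauss_lattice_minus)
qed

interpretation torus: discrete_affine_subgroup complex_add_group gauss_lattice
proof -
  interpret comm_group complex_add_group by (rule comm_group_complex_add_group)
  have inv: "m_inv complex_add_group = uminus"
    by (rule ext, rule inv_equality) (auto simp: complex_add_group_def)
  show "discrete_affine_subgroup complex_add_group gauss_lattice"
  proof (intro discrete_affine_subgroup.intro discrete_affine_subgroup_axioms.intro)
    show "affine_map (\<lambda>x. g \<otimes>\<^bsub>complex_add_group\<^esub> x)" for g
      by (rule affine_mapI[OF linear_id, of _ g]) (simp add: complex_add_group_def add.commute)
    have "ball 0 1 \<inter> gauss_lattice = {\<one>\<^bsub>complex_add_group\<^esub>}"
      using gauss_lattice_0 gauss_lattice_norm_less_1 by (auto simp: complex_add_group_def)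
    then show "\<exists>U. open U \<and> U \<inter> gauss_lattice = {\<one>\<^bsub>complex_add_group\<^esub>}"
      by blast
  qed (auto simp: inv subgroup_gauss_lattice is_group,
      auto simp: complex_add_group_def split_def intro!: continuous_intros)
qed

section \<open>Homology classes of deck transformations and compactness\<close>

text \<open>Powers are computed below by exhibiting a homomorphism from the integers with the right
  value at 1.\<close>

lemma (in group) int_pow_one_parameter:
  fixes n :: int
  assumes "\<And>a b :: int. f (a + b) = f a \<otimes> f b" "\<And>a. f a \<in> carrier G"
  shows "f 1 [^] n = f n"
proof (induction n rule: int_induct[where k = 0])
  case base
  have "f 0 \<otimes> f 0 = f 0"
    using assms(1)[of 0 0] by simp
  then have "f 0 = \<one>"
    using assms(2) l_cancel_one by blast
  then show ?case by simp
next
  case (step1 i)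
  then show ?case
    using assms by (simp add: int_pow_mult)
next
  case (step2 i)
  have "f (i - 1) \<otimes> f 1 = f i"
    using assms(1)[of "i - 1" 1] by simp
  moreover have "f 1 [^] (i - 1) \<otimes> f 1 = f 1 [^] i"
    using int_pow_mult[OF assms(2)[of 1], of "i - 1" 1] assms(2) by simp
  ultimately show ?case
    using step2 assms(2) by (metis int_pow_closed right_cancel)
qed

context inoue_data
begin

lemma elt_int_pow: "elt 0 v w [^]\<^bsub>S6\<^esub> (n :: int) = elt 0 (of_int n *\<^sub>R v) (of_int n * w)"
  using S6.int_pow_one_parameter[of "\<lambda>n. elt 0 (of_int n *\<^sub>R v) (of_int n * w)" n]
  by (simp add: S6_mult act_0 rot_0 algebra_simps)

lemma elt_1_int_pow: "elt 1 0 0 [^]\<^bsub>S6\<^esub> (n :: int) = elt (of_int n) 0 0"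
  using S6.int_pow_one_parameter[of "\<lambda>n. elt (of_int n) 0 0" n]
  by (simp add: S6_mult act_zero)

interpretation H1: comm_group M6.H1
  by (rule abelian_homology_group)

lemma elt_in_\<Gamma>: "w \<in> gauss_lattice \<Longrightarrow> elt (of_int n) (int_lat k) w \<in> \<Gamma>"
  unfolding \<Gamma>_eq std_\<Gamma>_def by blast

lemma elt_0_in_\<Gamma>: "w \<in> gauss_lattice \<Longrightarrow> elt 0 (int_lat k) w \<in> \<Gamma>"
  using elt_in_\<Gamma>[of w 0] by simp

text \<open>The two elements are conjugate by \<open>elt 1 0 0\<close>, and conjugates agree in the
  commutative group \<open>M6.H1\<close>.\<close>

lemma loop_class_act:
  assumes "w \<in> gauss_lattice"
  shows "M6.loop_class (elt 0 (act 1 (int_lat k)) (\<i> * w)) = M6.loop_class (elt 0 (int_lat k) w)"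
proof -
  have e: "elt 1 0 0 \<in> \<Gamma>"
    using elt_int_in_\<Gamma>[of 1] by simp
  have x: "elt 0 (int_lat k) w \<in> \<Gamma>"
    using assms by (rule elt_0_in_\<Gamma>)
  have y: "elt 0 (act 1 (int_lat k)) (\<i> * w) \<in> \<Gamma>"
    unfolding act_1_int_lat using assms gauss_lattice_\<i> elt_0_in_\<Gamma> by blast
  have "elt 1 0 0 \<otimes>\<^bsub>S6\<^esub> elt 0 (int_lat k) w = elt 0 (act 1 (int_lat k)) (\<i> * w) \<otimes>\<^bsub>S6\<^esub> elt 1 0 0"
    by (simp add: S6_mult act_zero rot_1)
  from arg_cong[OF this, of M6.loop_class] show ?thesis
    using e x y M6.loop_class_closed
    by (simp add: M6.loop_class_mult H1.m_comm[of "M6.loop_class (elt 1 0 0)"])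
qed

text \<open>Two applications of \<open>loop_class_act\<close> multiply \<open>w\<close> by \<i> *
  \<i> = - 1, so the class of \<open>w\<close> equals its own inverse.\<close>

lemma loop_class_gauss_torsion:
  assumes "w \<in> gauss_lattice"
  shows "M6.loop_class (elt 0 0 (2 * w)) = \<one>\<^bsub>M6.H1\<^esub>"
proof -
  have mem: "elt 0 0 w \<in> \<Gamma>" "elt 0 0 (- w) \<in> \<Gamma>"
    using assms elt_gauss_in_\<Gamma> gauss_lattice_minus by auto
  have "M6.loop_class (elt 0 0 (- w)) = M6.loop_class (elt 0 0 w)"
    using loop_class_act[OF assms, of 0] loop_class_act[OF gauss_lattice_\<i>[OF assms], of 0]
    by (simp add: int_lat_0 act_zero flip: mult.assoc)
  moreover have "elt 0 0 w \<otimes>\<^bsub>S6\<^esub> elt 0 0 (- w) = \<one>\<^bsub>S6\<^esub>" "elt 0 0 (2 * w) = elt 0 0 w \<otimes>\<^bsub>S6\<^esub> elt 0 0 w"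
    by (simp_all add: S6_mult S6_one act_zero rot_0)
  moreover have "M6.loop_class \<one>\<^bsub>S6\<^esub> = \<one>\<^bsub>M6.H1\<^esub>"
    using group_hom.hom_one[OF M6.loop_class_group_hom] by simp
  ultimately show ?thesis
    using mem by (metis M6.loop_class_mult)
qed

text \<open>The vector is \<open>act 1 v - v\<close> for a lattice vector \<open>v\<close>, and
  \<open>loop_class_act\<close> gives both parts the same class.\<close>

lemma loop_class_lat_torsion: "M6.loop_class (elt 0 (int_lat (det (m - mat 1) *s k)) 0) = \<one>\<^bsub>M6.H1\<^esub>"
proof -
  obtain l where l: "int_lat (det (m - mat 1) *s k) = act 1 (int_lat l) - int_lat l"
    using det_m_minus_1_multiple by blast
  let ?x = "elt 0 (int_lat (det (m - mat 1) *s k)) 0" and ?y = "elt 0 (int_lat l) 0"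
  have mem: "?x \<in> \<Gamma>" "?y \<in> \<Gamma>"
    using elt_lat_in_\<Gamma> by auto
  have "?x \<otimes>\<^bsub>S6\<^esub> ?y = elt 0 (act 1 (int_lat l)) 0"
    by (simp add: S6_mult act_0 l)
  then have "M6.loop_class ?x \<otimes>\<^bsub>M6.H1\<^esub> M6.loop_class ?y = M6.loop_class ?y"
    using loop_class_act[OF gauss_lattice_0, of l] mem by (simp flip: M6.loop_class_mult)
  then show ?thesis
    using mem M6.loop_class_closed by (simp add: H1.l_cancel_one)
qed

lemma loop_class_power:
  assumes "h \<in> \<Gamma>"
  shows "\<exists>k::int. M6.loop_class h [^]\<^bsub>M6.H1\<^esub> (2 * det (m - mat 1)) = M6.loop_class (elt 1 0 0) [^]\<^bsub>M6.H1\<^esub> k"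
proof -
  let ?D = "det (m - mat 1)"
  obtain n k w where h: "h = elt (of_int n) (int_lat k) w" and w: "w \<in> gauss_lattice"
    using assms unfolding \<Gamma>_eq std_\<Gamma>_def by blast
  let ?x = "elt 0 (int_lat k) w" and ?e = "elt 1 0 0"
  have mem: "?x \<in> \<Gamma>" "?e \<in> \<Gamma>" "elt (of_int n) 0 0 \<in> \<Gamma>"
    using elt_0_in_\<Gamma>[OF w] elt_int_in_\<Gamma>[of 1] elt_int_in_\<Gamma>[of n] by auto
  \<comment> \<open>The exponent 2 D is regrouped as D (2 k) on the lattice part and as 2 (D w) on
    the Gaussian part, to match the two torsion lemmas.\<close>
  have lat2: "of_int (2 * ?D) *\<^sub>R int_lat k = int_lat (?D *s (2 *s k))"
    unfolding int_lat_def linear_scale[OF linear_lat, symmetric]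
    by (intro arg_cong[of _ _ lat]) (simp add: vec_eq_iff)
  have w': "of_int ?D * w \<in> gauss_lattice"
    using of_int_scaleR_closed[of gauss_lattice w ?D] w gauss_lattice_0 gauss_lattice_add gauss_lattice_minus
    by (simp add: scaleR_conv_of_real)
  have "?x [^]\<^bsub>S6\<^esub> (2 * ?D) = elt 0 (int_lat (?D *s (2 *s k))) 0 \<otimes>\<^bsub>S6\<^esub> elt 0 0 (2 * (of_int ?D * w))"
    unfolding elt_int_pow lat2 by (simp add: S6_mult act_0 rot_0 elt_eq_iff)
  moreover have "elt 0 0 (2 * (of_int ?D * w)) \<in> \<Gamma>"
    unfolding mult_2 by (rule elt_gauss_in_\<Gamma>[OF gauss_lattice_add[OF w' w']])
  ultimately have "M6.loop_class ?x [^]\<^bsub>M6.H1\<^esub> (2 * ?D) = \<one>\<^bsub>M6.H1\<^esub>"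
    using elt_lat_in_\<Gamma> mem loop_class_lat_torsion loop_class_gauss_torsion[OF w']
    by (simp add: M6.loop_class_mult del: vector_smult_assoc flip: M6.loop_class_int_pow)
  moreover have "h = ?x \<otimes>\<^bsub>S6\<^esub> ?e [^]\<^bsub>S6\<^esub> n"
    unfolding elt_1_int_pow h by (simp add: S6_mult act_0 rot_0)
  then have "M6.loop_class h = M6.loop_class ?x \<otimes>\<^bsub>M6.H1\<^esub> M6.loop_class ?e [^]\<^bsub>M6.H1\<^esub> n"
    using mem by (simp add: M6.loop_class_mult elt_1_int_pow flip: M6.loop_class_int_pow)
  ultimately have "M6.loop_class h [^]\<^bsub>M6.H1\<^esub> (2 * ?D) = M6.loop_class ?e [^]\<^bsub>M6.H1\<^esub> (n * (2 * ?D))"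
    using mem M6.loop_class_closed by (simp add: H1.int_pow_distrib H1.int_pow_pow)
  then show ?thesis ..
qed

lemma betti_number_M6: "betti_number 1 (M6 c \<alpha> cv av) = 1"
proof (rule M6.betti_number_1_eq_1[where \<tau> = fst and g = "elt 1 0 0" and N = "2 * det (m - mat 1)"])
  show "fst (x \<otimes>\<^bsub>S6\<^esub> y) = fst x + fst y" for x y
    by (simp add: S_group_def split_def)
  show "fst h \<in> \<int>" if "h \<in> \<Gamma>" for h
    using that unfolding \<Gamma>_eq std_\<Gamma>_def by (auto simp: elt_def)
  show "elt 1 0 0 \<in> \<Gamma>" "fst (elt 1 0 0) \<noteq> 0"
    using elt_int_in_\<Gamma>[of 1] by (auto simp: elt_def)
qed (use det_m_minus_1 loop_class_power in \<open>auto intro!: continuous_intros\<close>)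

text \<open>Every orbit meets the compact set of points whose first coordinate, lattice coordinates
  and two real fibre coordinates all lie in the unit interval.\<close>

lemma compact_space_M6: "compact_space (M6 c \<alpha> cv av)"
proof -
  define f where "f = (\<lambda>(t, r, w). elt t (lat r) w)"
  define K where "K = {0..1::real} \<times> cbox (0 :: real^3) 1 \<times> cbox 0 (Complex 1 1)"
  have "continuous_on UNIV lat"
    using linear_lat by (simp add: linear_continuous_on linear_linear)
  then have "continuous_on K (\<lambda>x. lat (fst (snd x)))"
    by (rule continuous_on_compose2) (auto intro!: continuous_intros)
  then have "continuous_on K f"
    unfolding f_def elt_def split_def by (intro continuous_intros)
  moreover have "compact K"
    unfolding K_def by (intro compact_Times compact_Icc compact_cbox)
  ultimately have "compact (f ` K)"
    by (rule compact_continuous_image)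
  moreover have "topspace (M6 c \<alpha> cv av) \<subseteq> M6.proj ` (f ` K)"
  proof
    fix p assume "p \<in> topspace (M6 c \<alpha> cv av)"
    then obtain x where x: "p = M6.proj x"
      by (auto simp: M6.topspace_quot)
    obtain t v w where xe: "x = elt t v w"
      by (rule elt_cases)
    define n where "n = \<lfloor>t\<rfloor>"
    \<comment> \<open>The power of g_0 that reduces \<open>t\<close> also moves the other
      coordinates, so their integral parts are taken after it has acted.\<close>
    obtain r where r: "act (of_int (- n)) v = lat r"
      using surj_lat by (metis surjD)
    define k :: "int^3" where "k = (\<chi> j. \<lfloor>r $ j\<rfloor>)"
    define w' where "w' = rot (of_int (- n)) * w"
    define b where "b = of_int \<lfloor>Re w'\<rfloor> + \<i> * of_int \<lfloor>Im w'\<rfloor>"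
    have b: "b \<in> gauss_lattice"
      unfolding b_def gauss_lattice_def by blast
    have "elt (of_int (- n)) (int_lat (- k)) (- b) \<otimes>\<^bsub>S6\<^esub> x = elt (t - of_int n) (lat r - int_lat k) (w' - b)"
      by (simp add: xe S6_mult r[simplified] int_lat_minus w'_def)
    also have "lat r - int_lat k = lat (r - (\<chi> j. of_int (k $ j)))"
      by (simp add: int_lat_def linear_diff[OF linear_lat])
    finally have "M6.proj x = M6.proj (f (t - of_int n, r - (\<chi> j. of_int (k $ j)), w' - b))"
      using M6.proj_translate[OF elt_in_\<Gamma>[OF gauss_lattice_minus[OF b]]] by (metis f_def split_conv)
    moreover have "(t - of_int n, r - (\<chi> j. of_int (k $ j)), w' - b) \<in> K"
      unfolding K_def n_def k_def b_def
      by (auto simp: mem_box_cart in_cbox_complex_iff) (linarith+)?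
    ultimately show "p \<in> M6.proj ` (f ` K)"
      using x by blast
  qed
  moreover have "M6.proj ` (f ` K) \<subseteq> topspace (M6 c \<alpha> cv av)"
    by (auto simp: M6.topspace_quot)
  ultimately show ?thesis
    unfolding compact_space_def
    using image_compactin[OF _ M6.continuous_proj, of "f ` K"] by (metis compactin_euclidean_iff subset_antisym)
qed

end

section \<open>The torus bundle\<close>

context inoue_data
begin

definition join :: "real \<times> real \<times> complex \<Rightarrow> complex \<Rightarrow> real \<times> real \<times> complex \<times> complex" where
  "join y w = elt (fst y) (snd y) w"

definition fibre_coord :: "real \<times> real \<times> complex \<times> complex \<Rightarrow> complex" where
  "fibre_coord x = snd (snd (snd x))"

lemma forget_join [simp]: "forget (join y w) = y"
  by (simp add: join_def forget_elt)

lemma fibre_coord_join [simp]: "fibre_coord (join y w) = w"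
  by (simp add: join_def fibre_coord_def elt_def)

lemma join_forget [simp]: "join (forget x) (fibre_coord x) = x"
  by (cases x) (simp add: join_def forget_def fibre_coord_def elt_def)

lemma linear_forget: "linear forget"
  by (rule linearI) (auto simp: forget_def)

lemma linear_fibre_coord: "linear fibre_coord"
  by (rule linearI) (auto simp: fibre_coord_def)

lemma linear_join: "linear (\<lambda>z. join (fst z) (snd z))"
  by (rule linearI) (auto simp: join_def elt_def)

lemma elt_0_0_mult: "elt 0 0 g \<otimes>\<^bsub>S6\<^esub> x = join (forget x) (g + fibre_coord x)"
  by (cases x rule: elt_cases)
    (simp add: S6_mult act_0 rot_0 forget_elt join_def fibre_coord_def elt_eq_iff, simp add: elt_def)

lemma \<Gamma>_forget_one:
  assumes "g \<in> \<Gamma>" "forget g = \<one>\<^bsub>S4\<^esub>"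
  obtains w where "w \<in> gauss_lattice" "g = elt 0 0 w"
  using assms unfolding \<Gamma>_eq std_\<Gamma>_def by (auto simp: forget_elt S4_one)

lemma torus_proj_eq_iff: "torus.proj v = torus.proj w \<longleftrightarrow> (\<exists>g\<in>gauss_lattice. w = g + v)"
  unfolding torus.proj_eq_iff by (simp add: complex_add_group_def)

lemma M6_proj_gauss_translate:
  assumes "torus.proj v = torus.proj w"
  shows "M6.proj (join y v) = M6.proj (join y w)"
proof -
  obtain g where g: "g \<in> gauss_lattice" "w = g + v"
    using assms torus_proj_eq_iff by blast
  then have "join y w = elt 0 0 g \<otimes>\<^bsub>S6\<^esub> join y v"
    by (simp add: elt_0_0_mult)
  then show ?thesis
    using elt_gauss_in_\<Gamma>[OF g(1)] M6.proj_eq_iff by blast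
qed

text \<open>Points of the quotient are orbits, so the map goes through a chosen representative;
  \<open>base_map_proj\<close> is independence of the choice.\<close>

definition base_map :: "(real \<times> real \<times> complex \<times> complex) set \<Rightarrow> (real \<times> real \<times> complex) set" where
  "base_map p = M4.proj (forget (SOME x. M6.proj x = p))"

lemma base_map_proj: "base_map (M6.proj x) = M4.proj (forget x)"
proof -
  define y where "y = (SOME y. M6.proj y = M6.proj x)"
  have "M6.proj y = M6.proj x"
    unfolding y_def by (rule someI) simp
  then obtain g where g: "g \<in> \<Gamma>" "x = g \<otimes>\<^bsub>S6\<^esub> y"
    unfolding M6.proj_eq_iff by blast
  then have "forget g \<in> \<Lambda>" "forget x = forget g \<otimes>\<^bsub>S4\<^esub> forget y"
    by (auto simp: \<Lambda>_eq forget_mult)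
  then show ?thesis
    unfolding base_map_def y_def[symmetric] using M4.proj_eq_iff by blast
qed

lemma \<Lambda>_lift:
  assumes "M4.proj (forget x) \<in> M4.proj ` V"
  obtains g where "g \<in> \<Gamma>" "forget (g \<otimes>\<^bsub>S6\<^esub> x) \<in> V"
proof -
  obtain v where v: "v \<in> V" "M4.proj (forget x) = M4.proj v"
    using assms by (elim imageE)
  then obtain l where l: "l \<in> \<Lambda>" "v = l \<otimes>\<^bsub>S4\<^esub> forget x"
    using M4.proj_eq_iff by blast
  then obtain g where "g \<in> \<Gamma>" "l = forget g"
    unfolding \<Lambda>_eq by blast
  with v l show thesis
    by (intro that[of g]) (auto simp: forget_mult)
qed

text \<open>The fibre coordinate has a meaning modulo Gaussian integers only after the
  representative is moved over \<open>V\<close>, since a general element of \<open>\<Gamma>\<close>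
  also rotates it.\<close>

definition trivialization ::
  "(real \<times> real \<times> complex) set \<Rightarrow> (real \<times> real \<times> complex \<times> complex) set \<Rightarrow>
   (real \<times> real \<times> complex) set \<times> complex set" where
  "trivialization V p = (let y = SOME y. M6.proj y = p \<and> forget y \<in> V
     in (M4.proj (forget y), torus.proj (fibre_coord y)))"

definition inv_trivialization ::
  "(real \<times> real \<times> complex) set \<Rightarrow> (real \<times> real \<times> complex) set \<times> complex set \<Rightarrow>
   (real \<times> real \<times> complex \<times> complex) set" where
  "inv_trivialization V = (\<lambda>(b, \<tau>). M6.proj (join (inv_into V M4.proj b) (SOME w. torus.proj w = \<tau>)))"

text \<open>Two representatives over \<open>V\<close> have the same image in the base, hence by
  injectivity the same base coordinate. The element of \<open>\<Gamma>\<close> joining them then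
  fixes that coordinate and is a Gaussian translation.\<close>

lemma trivialization_proj:
  assumes V: "inj_on M4.proj V" and x: "forget x \<in> V"
  shows "trivialization V (M6.proj x) = (M4.proj (forget x), torus.proj (fibre_coord x))"
proof -
  define y where "y = (SOME y. M6.proj y = M6.proj x \<and> forget y \<in> V)"
  have y: "M6.proj y = M6.proj x" "forget y \<in> V"
    using someI[of "\<lambda>y. M6.proj y = M6.proj x \<and> forget y \<in> V" x] x unfolding y_def by auto
  then obtain g where g: "g \<in> \<Gamma>" "x = g \<otimes>\<^bsub>S6\<^esub> y"
    unfolding M6.proj_eq_iff by blast
  have "M4.proj (forget y) = M4.proj (forget x)"
    using y(1) base_map_proj by metis
  then have eq: "forget y = forget x"
    using V x y(2) by (simp add: inj_on_eq_iff)
  then have "forget g \<otimes>\<^bsub>S4\<^esub> forget y = forget y"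
    using forget_mult[of g y] g(2) by metis
  then have "forget g = \<one>\<^bsub>S4\<^esub>"
    using S4.l_cancel_one by simp
  with g(1) obtain w where w: "w \<in> gauss_lattice" "g = elt 0 0 w"
    by (rule \<Gamma>_forget_one)
  then have "fibre_coord x = w + fibre_coord y"
    unfolding g(2) w(2) elt_0_0_mult by simp
  then have "torus.proj (fibre_coord y) = torus.proj (fibre_coord x)"
    using w(1) torus_proj_eq_iff by blast
  with eq show ?thesis
    unfolding trivialization_def y_def[symmetric] by (simp add: Let_def)
qed

lemma inv_trivialization_proj:
  assumes V: "inj_on M4.proj V" and v: "v \<in> V"
  shows "inv_trivialization V (M4.proj v, torus.proj w) = M6.proj (join v w)"
proof -
  have "torus.proj (SOME w'. torus.proj w' = torus.proj w) = torus.proj w"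
    by (rule someI) simp
  then show ?thesis
    unfolding inv_trivialization_def split_conv inv_into_f_f[OF V v]
    by (rule M6_proj_gauss_translate)
qed

lemmas M6_cover = M6.affine_cover_quot
lemmas bundle_cover = affine_cover_prod[OF M4.affine_cover_quot torus.affine_cover_quot]

lemma smooth_base_map:
  "smooth_map_on (M6 c \<alpha> cv av) (M6_atlas c \<alpha> cv av) (inoue_surface c \<alpha> cv av) (inoue_atlas c \<alpha> cv av)
     (topspace (M6 c \<alpha> cv av)) base_map"
proof (rule smooth_map_on_locally_affine_lift[OF M6_cover M4.affine_cover_quot])
  show "\<exists>T g. open T \<and> x \<in> T \<and> affine_map g \<and>
      (\<forall>y\<in>T. M6.proj y \<in> topspace M6.quot \<longrightarrow> base_map (M6.proj y) = M4.proj (g y))" for x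
    using affine_map_linear[OF linear_forget] base_map_proj by (intro exI[of _ UNIV] exI[of _ forget]) auto
qed auto

text \<open>Both directions lift to affine maps: forwards, translate by an element of
  \<open>\<Gamma>\<close> that moves the point over \<open>V\<close> and read off its coordinates;
  backwards, translate the base point into \<open>V\<close> and attach the fibre coordinate.
  Continuity of the homeomorphism is part of this smoothness.\<close>

lemma local_trivialization:
  assumes V: "open V" "inj_on M4.proj V"
  defines "U \<equiv> M4.proj ` V"
  defines "P \<equiv> {x \<in> topspace (M6 c \<alpha> cv av). base_map x \<in> U}"
  defines "Q \<equiv> U \<times> topspace torus2"
  shows "homeomorphic_maps (subtopology (M6 c \<alpha> cv av) P)
      (subtopology (prod_topology (inoue_surface c \<alpha> cv av) torus2) Q)
      (trivialization V) (inv_trivialization V)" (is ?homeo)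
    and "smooth_map_on (M6 c \<alpha> cv av) (M6_atlas c \<alpha> cv av)
      (prod_topology (inoue_surface c \<alpha> cv av) torus2) (prod_atlas (inoue_atlas c \<alpha> cv av) torus2_atlas)
      P (trivialization V)" (is ?smooth1)
    and "smooth_map_on (prod_topology (inoue_surface c \<alpha> cv av) torus2)
      (prod_atlas (inoue_atlas c \<alpha> cv av) torus2_atlas) (M6 c \<alpha> cv av) (M6_atlas c \<alpha> cv av)
      Q (inv_trivialization V)" (is ?smooth2)
    and "x \<in> P \<Longrightarrow> fst (trivialization V x) = base_map x"
proof -
  have oU: "openin M4.quot U"
    using M4.open_map_proj V(1) by (simp add: U_def open_map_def)
  have oP: "openin M6.quot P"
    using smooth_base_map oU unfolding P_def smooth_map_on_def
    by (auto intro: openin_continuous_map_preimage)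
  have oQ: "openin (prod_topology M4.quot torus.quot) Q"
    using oU by (simp add: Q_def openin_prod_Times_iff)
  have P_cases: "\<exists>y. p = M6.proj y \<and> forget y \<in> V" if p: "p \<in> P" for p
  proof -
    obtain x where x: "p = M6.proj x"
      using p by (auto simp: P_def M6.topspace_quot)
    then have "M4.proj (forget x) \<in> M4.proj ` V"
      using p by (simp add: P_def U_def base_map_proj)
    then obtain g where "g \<in> \<Gamma>" "forget (g \<otimes>\<^bsub>S6\<^esub> x) \<in> V"
      by (rule \<Lambda>_lift)
    then show ?thesis
      using x M6.proj_translate by metis
  qed
  have P_I: "M6.proj y \<in> P" if "forget y \<in> V" for y
    using that by (simp add: P_def M6.topspace_quot base_map_proj U_def)
  have Q_cases: "\<exists>v w. q = (M4.proj v, torus.proj w) \<and> v \<in> V" if "q \<in> Q" for q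
    using that by (auto simp: Q_def U_def torus.topspace_quot)
  have Q_I: "(M4.proj v, torus.proj w) \<in> Q" if "v \<in> V" for v w
    using that by (simp add: Q_def U_def torus.topspace_quot)
  show smooth1: ?smooth1
  proof (rule smooth_map_on_locally_affine_lift[OF M6_cover bundle_cover oP])
    fix x assume "M6.proj x \<in> P"
    then have "M4.proj (forget x) \<in> M4.proj ` V"
      by (simp add: P_def U_def base_map_proj)
    then obtain g where g: "g \<in> \<Gamma>" "forget (g \<otimes>\<^bsub>S6\<^esub> x) \<in> V"
      by (rule \<Lambda>_lift)
    let ?T = "{y. forget (g \<otimes>\<^bsub>S6\<^esub> y) \<in> V}"
    let ?f = "\<lambda>y. (forget (g \<otimes>\<^bsub>S6\<^esub> y), fibre_coord (g \<otimes>\<^bsub>S6\<^esub> y))"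
    have aff: "affine_map (\<lambda>y. forget (g \<otimes>\<^bsub>S6\<^esub> y))"
      using affine_map_compose[OF affine_S6 affine_map_linear[OF linear_forget]] .
    then have "open ?T"
      using continuous_on_affine_map[OF aff, of UNIV] V(1) by (simp add: continuous_on_open_vimage vimage_def)
    moreover have "affine_map ?f"
      by (intro affine_map_Pair aff affine_map_compose[OF affine_S6 affine_map_linear[OF linear_fibre_coord]])
    moreover have "trivialization V (M6.proj y) = map_prod M4.proj torus.proj (?f y)" if "y \<in> ?T" for y
      using trivialization_proj[OF V(2), of "g \<otimes>\<^bsub>S6\<^esub> y"] that M6.proj_translate[OF g(1), of y] by simp
    ultimately show "\<exists>T f. open T \<and> x \<in> T \<and> affine_map f \<and>
        (\<forall>y\<in>T. M6.proj y \<in> P \<longrightarrow> trivialization V (M6.proj y) = map_prod M4.proj torus.proj (f y))"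
      using g(2) by blast
  qed
  show smooth2: ?smooth2
  proof (rule smooth_map_on_locally_affine_lift[OF bundle_cover M6_cover oQ])
    fix z assume z: "map_prod M4.proj torus.proj z \<in> Q"
    obtain v where v: "v \<in> V" "M4.proj (fst z) = M4.proj v"
      using z by (cases z) (auto simp: Q_def U_def)
    then obtain l where l: "l \<in> \<Lambda>" "l \<otimes>\<^bsub>S4\<^esub> fst z \<in> V"
      using M4.proj_eq_iff by metis
    let ?T = "{y :: (real \<times> real \<times> complex) \<times> complex. l \<otimes>\<^bsub>S4\<^esub> fst y \<in> V}"
    \<comment> \<open>Only the base point is moved; the fibre coordinate is already the one
      belonging to the representative over \<open>V\<close>.\<close>
    let ?f = "\<lambda>y. join (l \<otimes>\<^bsub>S4\<^esub> fst y) (snd y)"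
    have aff: "affine_map (\<lambda>y :: (real \<times> real \<times> complex) \<times> complex. l \<otimes>\<^bsub>S4\<^esub> fst y)"
      using affine_map_compose[OF affine_map_linear[OF linear_fst] affine_S4] .
    then have "open ?T"
      using continuous_on_affine_map[OF aff, of UNIV] V(1) by (simp add: continuous_on_open_vimage vimage_def)
    moreover have "affine_map ?f"
      using affine_map_compose[OF affine_map_Pair[OF aff affine_map_linear[OF linear_snd]]
          affine_map_linear[OF linear_join]] by simp
    moreover have "inv_trivialization V (map_prod M4.proj torus.proj y) = M6.proj (?f y)" if "y \<in> ?T" for y
      using inv_trivialization_proj[OF V(2), of "l \<otimes>\<^bsub>S4\<^esub> fst y" "snd y"] that
        M4.proj_translate[OF l(1), of "fst y"] by (cases y) simp
    ultimately show "\<exists>T f. open T \<and> z \<in> T \<and> affine_map f \<and>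
        (\<forall>y\<in>T. map_prod M4.proj torus.proj y \<in> Q \<longrightarrow>
           inv_trivialization V (map_prod M4.proj torus.proj y) = M6.proj (f y))"
      using l(2) by blast
  qed
  show "fst (trivialization V x) = base_map x" if "x \<in> P" for x
    using P_cases[OF that] trivialization_proj[OF V(2)] base_map_proj by auto
  have h: "trivialization V p \<in> Q \<and> inv_trivialization V (trivialization V p) = p" if p: "p \<in> P" for p
  proof -
    obtain y where "p = M6.proj y" "forget y \<in> V"
      using P_cases[OF p] by blast
    then show ?thesis
      using trivialization_proj[OF V(2)] inv_trivialization_proj[OF V(2)] Q_I by simp
  qed
  have k: "inv_trivialization V q \<in> P \<and> trivialization V (inv_trivialization V q) = q" if q: "q \<in> Q" for q
  proof -
    obtain v w where "q = (M4.proj v, torus.proj w)" "v \<in> V"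
      using Q_cases[OF q] by blast
    then show ?thesis
      using trivialization_proj[OF V(2)] inv_trivialization_proj[OF V(2)] P_I by simp
  qed
  have "P \<subseteq> topspace M6.quot" "Q \<subseteq> topspace (prod_topology M4.quot torus.quot)"
    using oP oQ by (blast dest: openin_subset)+
  then show ?homeo
    using smooth1 smooth2 h k unfolding homeomorphic_maps_def smooth_map_on_def
    by (auto simp: continuous_map_in_subtopology simp del: topspace_prod_topology)
qed

lemma smooth_fibre_bundle_M6:
  "smooth_fibre_bundle (M6 c \<alpha> cv av) (M6_atlas c \<alpha> cv av)
     (inoue_surface c \<alpha> cv av) (inoue_atlas c \<alpha> cv av) torus2 torus2_atlas base_map"
  unfolding smooth_fibre_bundle_def
proof (intro conjI ballI)
  show "base_map ` topspace (M6 c \<alpha> cv av) = topspace (inoue_surface c \<alpha> cv av)"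
  proof -
    have "M4.proj y \<in> base_map ` range M6.proj" for y
      using base_map_proj[of "join y 0"] by force
    then show ?thesis
      unfolding M6.topspace_quot M4.topspace_quot by (auto simp: base_map_proj)
  qed
  fix b assume "b \<in> topspace (inoue_surface c \<alpha> cv av)"
  then obtain y where y: "b = M4.proj y"
    by (auto simp: M4.topspace_quot)
  obtain V where V: "open V" "y \<in> V" "inj_on M4.proj V"
    using M4.locally_injective by blast
  have "openin M4.quot (M4.proj ` V)" "b \<in> M4.proj ` V"
    using M4.open_map_proj V y by (auto simp: open_map_def)
  with local_trivialization[OF V(1,3)]
  show "\<exists>U h k. openin (inoue_surface c \<alpha> cv av) U \<and> b \<in> U \<and>
        (let P = {x \<in> topspace (M6 c \<alpha> cv av). base_map x \<in> U}; Q = U \<times> topspace torus2 in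
           homeomorphic_maps (subtopology (M6 c \<alpha> cv av) P)
             (subtopology (prod_topology (inoue_surface c \<alpha> cv av) torus2) Q) h k \<and>
           smooth_map_on (M6 c \<alpha> cv av) (M6_atlas c \<alpha> cv av) (prod_topology (inoue_surface c \<alpha> cv av) torus2)
             (prod_atlas (inoue_atlas c \<alpha> cv av) torus2_atlas) P h \<and>
           smooth_map_on (prod_topology (inoue_surface c \<alpha> cv av) torus2)
             (prod_atlas (inoue_atlas c \<alpha> cv av) torus2_atlas) (M6 c \<alpha> cv av) (M6_atlas c \<alpha> cv av) Q k \<and>
           (\<forall>x\<in>P. fst (h x) = base_map x))"
    unfolding Let_def
    by (intro exI[of _ "M4.proj ` V"] exI[of _ "trivialization V"] exI[of _ "inv_trivialization V"] conjI ballI)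
qed (rule M6.smooth_manifold_quot M4.smooth_manifold_quot torus.smooth_manifold_quot smooth_base_map)+

end

theorem proposition3p2:
  fixes m :: "int^3^3" and c :: real and \<alpha> :: complex
    and cv :: "real^3" and av :: "complex^3"
  assumes "det m = 1"
    and "\<alpha> \<notin> \<real>" and "c \<notin> \<rat>" and "c > 1" and "(cmod \<alpha>)\<^sup>2 * c = 1"
    and "cv \<noteq> 0" and "map_matrix real_of_int m *v cv = c *s cv"
    and "av \<noteq> 0" and "map_matrix complex_of_int m *v av = \<alpha> *s av"
  shows "compact_space (M6 c \<alpha> cv av) \<and>
    (\<exists>p. smooth_fibre_bundle (M6 c \<alpha> cv av) (M6_atlas c \<alpha> cv av)
           (inoue_surface c \<alpha> cv av) (inoue_atlas c \<alpha> cv av) torus2 torus2_atlas p) \<and>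
    betti_number 1 (M6 c \<alpha> cv av) = 1"
proof -
  interpret inoue_data m c \<alpha> cv av
    using assms by unfold_locales
  show ?thesis
    using compact_space_M6 smooth_fibre_bundle_M6 betti_number_M6 by blast
qed

end
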